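(* Let $u,v\in\mathbb{C}$ be such that $$\left|\frac{u-s}{1-su}\cdot\frac{v-s}{1-sv}\right|<1.$$ Then for any nonnegative signatures $\lambda$ and $\mu$, $$\sum_\nu F_{\nu/\lambda}(u)\,G^c_{\nu/\mu}(v)=\frac{1-quv}{1-uv}\sum_\kappa G^c_{\lambda/\kappa}(v)\,F_{\mu/\kappa}(u),$$ where both summations are over the set of all nonnegative signatures (of all lengths, including the empty signature).
   Context: Throughout, $q,s$ are fixed generic complex parameters, and variables are such that no denominator vanishes. $(a;q)_n=\prod_{r=0}^{n-1}(1-aq^r)$ for $n\ge1$, $(a;q)_0=1$. Signatures: a signature of length $L$ is a string of integers $\lambda=(\lambda_1\ge\dots\ge\lambda_L)$; $\mathrm{Sign}_L$ is the set of all of them, $\mathrm{Sign}_L^+$ those with nonnegative entries; $\mathrm{Sign}_0=\mathrm{Sign}_0^+=\{\varnothing\}$. The set of all nonnegative signatures is $\bigsqcup_{L\ge0}\mathrm{Sign}_L^+$. Multiplicative notation: $\lambda=0^{m_0}1^{m_1}2^{m_2}\cdots$ with $m_j=|\{i:\lambda_i=j\}|$. Vertex weights: for $u\in\mathbb{C}$ and integers $m\ge 0$, $w_u(m,0;m,0)=\frac{1-sq^mu}{1-su}$, $w_u(m,1;m,1)=\frac{u-sq^m}{1-su}$, $w_u(m+1,0;m,1)=\frac{(1-s^2q^m)u}{1-su}$, $w_u(m,1;m+1,0)=\frac{1-q^{m+1}}{1-su}$, and $w_u(i_1,j_1;i_2,j_2)=0$ for all other nonnegative integers. Path weights: in the square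 grid, assign to each vertex $(i,j)$ the variable $u_j$ (constant along rows). A vertex is interior to an up-right path if it lies on the path and is not its beginning or ending vertex. The weight of a finite collection of up-right paths is the product, over all vertices interior to the paths of the collection, of $w_{u_j}(i_1,j_1;i_2,j_2)$, where $i_1,j_1,i_2,j_2$ are the numbers of paths of the collection containing the South, West, North, East edge at the vertex (weight $1$ if there are no interior vertices). Two collections are identified if they have the same interior vertices and the same numbers $(i_1,j_1,i_2,j_2)$ at each of them. $F$: for $L\ge M\ge0$, $\lambda\in\mathrm{Sign}^+_L$, $\mu\in\mathrm{Sign}^+_M$, $F_{\lambda/\mu}(u_1,\dots,u_{L-M})$ is the sum of weights of all collections of $L$ up-right paths that start with the vertical edges $(\mu_m,0)\to(\mu_m,1)$, $1\le m\le M$, and the horizontal edges $(-1,j)\to(0,j)$, $1\le j\le L-M$, and end with the vertical edges $(\lambda_l,L-M)\to(\lambda_l,L-M+1)$, $1\le l\le L$. By convention $F_{\lambda/\mu}$ of $r$ variables is $0$ unless the length of $\lambda$ equals the length of $\mu$ plus $r$. $G$: for $L,k\ge0$, $\lambda,\nu\in\mathrm{Sign}_L$, $G_{\lambda/\nu}(u_1,\dots,u_k)$ is the sum of weights of all collections of $L$ up-right paths that start with the vertical edges $(\nu_n,0)\to(\nu_n,1)$, $1\le n\le L$, and end with the vertical edges $(\lambda_l,k)\to(\lambda_l,k+1)$, $1\le l\le L$. By convention $G_{\lambda/\nu}=0$ if $\lambda,\nu$ have different lengths. Conjugation: for $\nu=0^{n_0}1^{n_1}2^{n_2}\cdots$ put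 $c(\nu)=\prod_{k\ge0}\frac{(s^2;q)_{n_k}}{(q;q)_{n_k}}$, and $G^c_{\lambda/\mu}=\frac{c(\lambda)}{c(\mu)}G_{\lambda/\mu}$. *)

theory Defs
  imports "HOL-Analysis.Infinite_Sum" "HOL-Library.Multiset"
begin

definition qpoch :: "complex \<Rightarrow> complex \<Rightarrow> nat \<Rightarrow> complex" where
  "qpoch a q n = (\<Prod>r<n. 1 - a * q ^ r)"

text \<open>Signatures of length \<open>L\<close> are weakly decreasing integer lists of length \<open>L\<close>.\<close>

definition nonneg_signatures :: "int list set" where
  "nonneg_signatures = {\<nu>. sorted_wrt (\<ge>) \<nu> \<and> (\<forall>x\<in>set \<nu>. x \<ge> 0)}"

text \<open>The arguments \<open>i1 j1 i2 j2\<close> are the occupation numbers of the South, West, North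
  and East edge.\<close>

definition vertex_weight ::
    "complex \<Rightarrow> complex \<Rightarrow> complex \<Rightarrow> nat \<Rightarrow> nat \<Rightarrow> nat \<Rightarrow> nat \<Rightarrow> complex" where
  "vertex_weight q s u i1 j1 i2 j2 =
     (if j1 = 0 \<and> j2 = 0 \<and> i2 = i1 then (1 - s * q ^ i1 * u) / (1 - s * u)
      else if j1 = 1 \<and> j2 = 1 \<and> i2 = i1 then (u - s * q ^ i1) / (1 - s * u)
      else if j1 = 0 \<and> j2 = 1 \<and> i1 = i2 + 1 then (1 - s\<^sup>2 * q ^ i2) * u / (1 - s * u)
      else if j1 = 1 \<and> j2 = 0 \<and> i2 = i1 + 1 then (1 - q ^ (i1 + 1)) / (1 - s * u)
      else 0)"

type_synonym vertex = "int \<times> int"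
type_synonym edge = "vertex \<times> vertex"
type_synonym path = "vertex list"

text \<open>A path is given by its successive vertices; it has at least one edge.\<close>

definition up_right_path :: "path \<Rightarrow> bool" where
  "up_right_path p \<longleftrightarrow> length p \<ge> 2 \<and>
     (\<forall>i. Suc i < length p \<longrightarrow>
        p ! Suc i = (fst (p ! i) + 1, snd (p ! i)) \<or>
        p ! Suc i = (fst (p ! i), snd (p ! i) + 1))"

definition path_edges :: "path \<Rightarrow> edge set" where
  "path_edges p = {(p ! i, p ! Suc i) | i. Suc i < length p}"

definition first_edge :: "path \<Rightarrow> edge" where
  "first_edge p = (p ! 0, p ! 1)"

definition last_edge :: "path \<Rightarrow> edge" where
  "last_edge p = (p ! (length p - 2), p ! (length p - 1))"

definition path_interior :: "path \<Rightarrow> vertex set" where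
  "path_interior p = set p - {hd p, last p}"

text \<open>Collections of paths are multisets, since several paths of a collection may coincide.\<close>

definition collections :: "edge list \<Rightarrow> edge list \<Rightarrow> path multiset set" where
  "collections starts ends =
     {C. (\<forall>p\<in>#C. up_right_path p) \<and>
         image_mset first_edge C = mset starts \<and> image_mset last_edge C = mset ends}"

definition interior_vertices :: "path multiset \<Rightarrow> vertex set" where
  "interior_vertices C = (\<Union>p\<in>set_mset C. path_interior p)"

definition edge_count :: "path multiset \<Rightarrow> edge \<Rightarrow> nat" where
  "edge_count C e = size {#p \<in># C. e \<in> path_edges p#}"

type_synonym configuration = "vertex \<Rightarrow> (nat \<times> nat \<times> nat \<times> nat) option"

text \<open>Two collections are identified iff they have the same configuration: the domain
  consists of the interior vertices, the values are the numbers \<open>(i1, j1, i2, j2)\<close> there.\<close>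

definition configuration_of :: "path multiset \<Rightarrow> configuration" where
  "configuration_of C = (\<lambda>(x, y).
     if (x, y) \<in> interior_vertices C
     then Some (edge_count C ((x, y - 1), (x, y)), edge_count C ((x - 1, y), (x, y)),
                edge_count C ((x, y), (x, y + 1)), edge_count C ((x, y), (x + 1, y)))
     else None)"

text \<open>The variable of row \<open>y\<close> (counted from 1) is the list entry of index \<open>y - 1\<close>; in the
  collections entering \<open>F_fun\<close> and \<open>G_fun\<close> all interior vertices lie in
  rows \<open>1, \<dots>, length us\<close>.\<close>

definition configuration_weight ::
    "complex \<Rightarrow> complex \<Rightarrow> complex list \<Rightarrow> configuration \<Rightarrow> complex" where
  "configuration_weight q s us c =
     (\<Prod>(x, y)\<in>dom c. case the (c (x, y)) of
        (i1, j1, i2, j2) \<Rightarrow> vertex_weight q s (us ! nat (y - 1)) i1 j1 i2 j2)"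

definition partition_function ::
    "complex \<Rightarrow> complex \<Rightarrow> complex list \<Rightarrow> edge list \<Rightarrow> edge list \<Rightarrow> complex" where
  "partition_function q s us starts ends =
     (\<Sum>c\<in>configuration_of ` collections starts ends. configuration_weight q s us c)"

definition vertical_edges :: "int \<Rightarrow> int list \<Rightarrow> edge list" where
  "vertical_edges y \<nu> = map (\<lambda>x. ((x, y), (x, y + 1))) \<nu>"

definition left_edges :: "nat \<Rightarrow> edge list" where
  "left_edges k = map (\<lambda>j. ((-1, int j), (0, int j))) [1..<Suc k]"

text \<open>\<open>F_fun q s lam \<mu> us\<close> is \<open>F\<close> with skew index \<open>lam/\<mu>\<close>
  and variables \<open>us\<close>, and likewise for \<open>G_fun\<close>.\<close>

definition F_fun ::
    "complex \<Rightarrow> complex \<Rightarrow> int list \<Rightarrow> int list \<Rightarrow> complex list \<Rightarrow> complex" where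
  "F_fun q s lam \<mu> us =
     (if length lam = length \<mu> + length us
      then partition_function q s us
             (vertical_edges 0 \<mu> @ left_edges (length us))
             (vertical_edges (int (length us)) lam)
      else 0)"

definition G_fun ::
    "complex \<Rightarrow> complex \<Rightarrow> int list \<Rightarrow> int list \<Rightarrow> complex list \<Rightarrow> complex" where
  "G_fun q s lam \<nu> us =
     (if length lam = length \<nu>
      then partition_function q s us
             (vertical_edges 0 \<nu>) (vertical_edges (int (length us)) lam)
      else 0)"

text \<open>For \<open>\<nu>\<close> in \<open>nonneg_signatures\<close> this is the product over all \<open>k \<ge> 0\<close>:
  the factors with \<open>k\<close> not in \<open>set \<nu>\<close> have multiplicity 0 and are equal to 1.\<close>

definition conj_factor :: "complex \<Rightarrow> complex \<Rightarrow> int list \<Rightarrow> complex" where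
  "conj_factor q s \<nu> =
     (\<Prod>k\<in>set \<nu>. qpoch (s\<^sup>2) q (count_list \<nu> k) / qpoch q q (count_list \<nu> k))"

definition Gc_fun ::
    "complex \<Rightarrow> complex \<Rightarrow> int list \<Rightarrow> int list \<Rightarrow> complex list \<Rightarrow> complex" where
  "Gc_fun q s lam \<mu> us = conj_factor q s lam / conj_factor q s \<mu> * G_fun q s lam \<mu> us"

end

theory Submission
  imports Defs
begin

text \<open>A collection of paths in a single row is determined by the occupation numbers of its vertical
  edges, so \<open>F\<close> and \<open>G\<^sup>c\<close> in one variable are products of local weights over the columns, and either
  side of the identity is a two-row transfer product: on the left the shared signature \<open>\<nu>\<close> lies
  above both \<open>\<lambda>\<close> and \<open>\<mu>\<close>, on the right \<open>\<kappa>\<close> lies below both. A \<open>4 \<times> 4\<close> matrix \<open>S\<close> acting on the pairs of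
  horizontal edges intertwines the columns of the two products (Yang--Baxter). On the left boundary
  state \<open>(1, 0)\<close> it acts by \<open>1 - q u v\<close>. At the other end, the infinitely many empty columns of the
  left-hand side sum to a geometric series, whose boundary vector is exactly \<open>S\<close> applied to
  the empty state, divided by \<open>1 - u v\<close>. Absolute convergence follows from the same computation
  carried out with the absolute values of the weights.\<close>

section \<open>Transfer products\<close>

text \<open>The state \<open>a\<close> is the occupation of the edge entering from the left; the
  lists hold the vertical occupation numbers below and above. Horizontal edges range over
  \<open>{0, 1}\<close> only, since the vertex weights vanish at larger East values, and the empty
  case forbids a path to leave on the right. The semiring is open so that absolute values can serve
  as weights.\<close>

fun row_weight ::
    "(nat \<Rightarrow> nat \<Rightarrow> nat \<Rightarrow> nat \<Rightarrow> 'f::comm_semiring_1) \<Rightarrow> nat \<Rightarrow> nat list \<Rightarrow> nat list \<Rightarrow> 'f" where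
  "row_weight w a (l # ls) (n # ns) =
     (\<Sum>a'\<in>{0, 1}. w l a n a' * row_weight w a' ls ns)"
| "row_weight w a [] [] = of_bool (a = 0)"
| "row_weight w a _ _ = 0"

text \<open>Exchanging South and North puts the signature summed over into the same argument place
  on both sides of the identity.\<close>

definition reflect :: "('i \<Rightarrow> 'j \<Rightarrow> 'i \<Rightarrow> 'j \<Rightarrow> 'f) \<Rightarrow> 'i \<Rightarrow> 'j \<Rightarrow> 'i \<Rightarrow> 'j \<Rightarrow> 'f" where
  "reflect w i1 j1 i2 j2 = w i2 j1 i1 j2"

lemma row_weight_reflect: "row_weight (reflect w) a ns ls = row_weight w a ls ns"
  by (induction w a ls ns rule: row_weight.induct) (auto simp: reflect_def)

lemma norm_row_weight_le:
  fixes w :: "nat \<Rightarrow> nat \<Rightarrow> nat \<Rightarrow> nat \<Rightarrow> complex"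
  shows "norm (row_weight w a ls ns) \<le> row_weight (\<lambda>i j k l. norm (w i j k l)) a ls ns"
proof (induction w a ls ns rule: row_weight.induct)
  case (1 w a l ls n ns)
  have "norm (row_weight w a (l # ls) (n # ns))
      \<le> (\<Sum>a'\<in>{0, 1}. norm (w l a n a') * norm (row_weight w a' ls ns))"
    by (simp flip: norm_mult add: norm_triangle_ineq)
  also have "\<dots> \<le> row_weight (\<lambda>i j k l. norm (w i j k l)) a (l # ls) (n # ns)"
    unfolding row_weight.simps by (intro sum_mono mult_left_mono 1) auto
  finally show ?case .
qed auto

text \<open>One column of two rows that share the vertical number \<open>n\<close>. The cut-off
  \<open>K\<close> keeps the sum finite; it is later taken so large that no nonzero term is
  lost.\<close>

definition column ::
    "(nat \<Rightarrow> nat \<Rightarrow> nat \<Rightarrow> nat \<Rightarrow> 'f::comm_semiring_1) \<Rightarrow> (nat \<Rightarrow> nat \<Rightarrow> nat \<Rightarrow> nat \<Rightarrow> 'f) \<Rightarrow> nat \<Rightarrow>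
     nat \<Rightarrow> nat \<Rightarrow> nat \<Rightarrow> nat \<Rightarrow> nat \<Rightarrow> nat \<Rightarrow> 'f" where
  "column w1 w2 K l m a b a' b' = (\<Sum>n\<le>K. w1 l a n a' * w2 m b n b')"

text \<open>The vector \<open>\<phi>\<close> is the boundary condition at the right end. Keeping it
  free allows limits and the exchange matrix to pass through the columns.\<close>

fun transfer ::
    "(nat \<Rightarrow> nat \<Rightarrow> nat \<Rightarrow> nat \<Rightarrow> 'f::comm_semiring_1) \<Rightarrow> (nat \<Rightarrow> nat \<Rightarrow> nat \<Rightarrow> nat \<Rightarrow> 'f) \<Rightarrow> nat \<Rightarrow>
     (nat \<Rightarrow> nat \<Rightarrow> 'f) \<Rightarrow> nat \<Rightarrow> nat \<Rightarrow> nat list \<Rightarrow> nat list \<Rightarrow> 'f" where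
  "transfer w1 w2 K \<phi> a b (l # ls) (m # ms) =
     (\<Sum>a'\<in>{0, 1}. \<Sum>b'\<in>{0, 1}. column w1 w2 K l m a b a' b' * transfer w1 w2 K \<phi> a' b' ls ms)"
| "transfer w1 w2 K \<phi> a b _ _ = \<phi> a b"

lemma transfer_append:
  assumes "length ls = length ms"
  shows "transfer w1 w2 K \<phi> a b (ls @ ls') (ms @ ms') =
         transfer w1 w2 K (\<lambda>a b. transfer w1 w2 K \<phi> a b ls' ms') a b ls ms"
  using assms by (induction ls ms arbitrary: a b rule: list_induct2) auto

lemma transfer_cong:
  assumes "\<And>a b. a \<le> 1 \<Longrightarrow> b \<le> 1 \<Longrightarrow> \<phi> a b = \<psi> a b" and "a \<le> 1" and "b \<le> 1"
  shows "transfer w1 w2 K \<phi> a b ls ms = transfer w1 w2 K \<psi> a b ls ms"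
  using assms(2,3)
proof (induction ls arbitrary: a b ms)
  case Nil
  then show ?case using assms(1) by simp
next
  case (Cons l ls)
  then show ?case using assms(1) by (cases ms) auto
qed

lemma tendsto_transfer:
  fixes w1 w2 :: "nat \<Rightarrow> nat \<Rightarrow> nat \<Rightarrow> nat \<Rightarrow> 'f::real_normed_field"
  assumes "\<And>a b. a \<le> 1 \<Longrightarrow> b \<le> 1 \<Longrightarrow> ((\<lambda>k. \<phi> k a b) \<longlongrightarrow> \<psi> a b) G" and "a \<le> 1" and "b \<le> 1"
  shows "((\<lambda>k. transfer w1 w2 K (\<phi> k) a b ls ms) \<longlongrightarrow> transfer w1 w2 K \<psi> a b ls ms) G"
  using assms(2,3)
proof (induction ls arbitrary: a b ms)
  case Nil
  then show ?case using assms(1) by simp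
next
  case (Cons l ls)
  show ?case
  proof (cases ms)
    case Nil
    then show ?thesis using assms(1) Cons.prems by simp
  next
    case (Cons m ms')
    then show ?thesis
      by (auto intro!: tendsto_intros Cons.IH)
  qed
qed

section \<open>Summation over the vertical edges shared by two rows\<close>

definition empty_state :: "nat \<Rightarrow> nat \<Rightarrow> 'f::comm_semiring_1" where
  "empty_state a b = of_bool (a = 0 \<and> b = 0)"

lemma sum_lists_Suc:
  "(\<Sum>ns | set ns \<subseteq> {..K} \<and> length ns = Suc t. f ns) =
   (\<Sum>n\<le>K. \<Sum>ns | set ns \<subseteq> {..K::nat} \<and> length ns = t. f (n # ns))"
proof -
  have "{ns. set ns \<subseteq> {..K} \<and> length ns = Suc t} =
        (\<lambda>(n, ns). n # ns) ` ({..K} \<times> {ns. set ns \<subseteq> {..K} \<and> length ns = t})"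
    by (auto simp: length_Suc_conv image_iff)
  then show ?thesis
    by (simp add: sum.reindex inj_on_def sum.cartesian_product case_prod_unfold)
qed

lemma sum_row_weights:
  fixes w1 w2 :: "nat \<Rightarrow> nat \<Rightarrow> nat \<Rightarrow> nat \<Rightarrow> 'f::comm_semiring_1"
  assumes "length ls = length ms"
  shows "(\<Sum>ns | set ns \<subseteq> {..K} \<and> length ns = length ls. row_weight w1 a ls ns * row_weight w2 b ms ns)
         = transfer w1 w2 K empty_state a b ls ms"
  using assms
proof (induction ls ms arbitrary: a b rule: list_induct2)
  case Nil
  have "{ns. set ns \<subseteq> {..K} \<and> ns = []} = {[]}" by auto
  then show ?case by (simp add: empty_state_def)
next
  case (Cons l ls m ms)
  let ?T = "{ns. set ns \<subseteq> {..K} \<and> length ns = length ls}"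
  have "(\<Sum>ns | set ns \<subseteq> {..K} \<and> length ns = length (l # ls).
          row_weight w1 a (l # ls) ns * row_weight w2 b (m # ms) ns)
     = (\<Sum>n\<le>K. \<Sum>ns\<in>?T. \<Sum>a'\<in>{0, 1}. \<Sum>b'\<in>{0, 1}.
          (w1 l a n a' * w2 m b n b') * (row_weight w1 a' ls ns * row_weight w2 b' ms ns))"
    unfolding list.size add_0_right add_Suc_right sum_lists_Suc row_weight.simps sum_product
    by (simp add: mult_ac)
  also have "\<dots> = (\<Sum>a'\<in>{0, 1}. \<Sum>b'\<in>{0, 1}. \<Sum>n\<le>K. \<Sum>ns\<in>?T.
          (w1 l a n a' * w2 m b n b') * (row_weight w1 a' ls ns * row_weight w2 b' ms ns))"
    \<comment> \<open>Naming the index sets gives the exchange a direction: only the two-element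
      sums move outward.\<close>
    by (simp only: sum.swap[of _ "{0, 1}" ?T] sum.swap[of _ "{0, 1}" "{..K}"])
  also have "\<dots> = transfer w1 w2 K empty_state a b (l # ls) (m # ms)"
    by (simp only: transfer.simps flip: Cons.IH sum_product column_def)
  finally show ?case .
qed

text \<open>The conditions under which the columns beyond both signatures contribute a geometric series
  with ratio \<open>r\<close>: they preserve the difference of the two horizontal edges, and the states
  \<open>(0, 0)\<close> and \<open>(1, 1)\<close> communicate in one direction only.\<close>

definition stable :: "(nat \<Rightarrow> nat \<Rightarrow> nat \<Rightarrow> nat \<Rightarrow> 'f::comm_ring_1) \<Rightarrow> (nat \<Rightarrow> nat \<Rightarrow> nat \<Rightarrow> nat \<Rightarrow> 'f) \<Rightarrow> 'f \<Rightarrow> bool"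
  where "stable w1 w2 r \<longleftrightarrow>
    (\<forall>n. w1 0 0 n 0 * w2 0 0 n 0 = of_bool (n = 0)) \<and>
    (\<forall>n. w1 0 1 n 1 * w2 0 1 n 1 = (if n = 0 then r else 0)) \<and>
    (\<forall>n a b a' b'. of_bool a + of_bool b' \<noteq> (of_bool a' + of_bool b :: nat) \<longrightarrow>
       w1 0 (of_bool a) n (of_bool a') * w2 0 (of_bool b) n (of_bool b') = 0) \<and>
    ((\<forall>n. w1 0 0 n 1 * w2 0 0 n 1 = 0) \<or> (\<forall>n. w1 0 1 n 0 * w2 0 1 n 0 = 0))"

text \<open>Limit of the vector produced by \<open>k\<close> empty columns as \<open>k\<close>
  grows; the factor \<open>1 / (1 - r)\<close> sums over the number of columns spent in state
  \<open>(1, 1)\<close> before the drop to \<open>(0, 0)\<close>.\<close>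

definition limit_state ::
    "(nat \<Rightarrow> nat \<Rightarrow> nat \<Rightarrow> nat \<Rightarrow> 'f::field) \<Rightarrow> (nat \<Rightarrow> nat \<Rightarrow> nat \<Rightarrow> nat \<Rightarrow> 'f) \<Rightarrow> nat \<Rightarrow> 'f \<Rightarrow> nat \<Rightarrow> nat \<Rightarrow> 'f"
  where "limit_state w1 w2 K r a b =
    (if a = 0 \<and> b = 0 then 1
     else if a = 1 \<and> b = 1 then column w1 w2 K 0 0 1 1 0 0 / (1 - r) else 0)"

text \<open>Each condition only prescribes products, as zero or by value, so it survives absolute
  values. This supplies the dominating series.\<close>

lemma stable_norm:
  fixes w1 w2 :: "nat \<Rightarrow> nat \<Rightarrow> nat \<Rightarrow> nat \<Rightarrow> complex"
  assumes "stable w1 w2 r"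
  shows "stable (\<lambda>i j k l. norm (w1 i j k l)) (\<lambda>i j k l. norm (w2 i j k l)) (norm r)"
  using assms unfolding stable_def by (simp flip: norm_mult)

text \<open>Balance keeps a state with \<open>a \<noteq> b\<close> fixed, so it never becomes empty.
  From \<open>(1, 1)\<close> the pair waits \<open>i < k\<close> columns with weight
  \<open>r ^ i\<close>, drops to \<open>(0, 0)\<close> and stays there with weight
  \<open>1\<close>.\<close>

lemma transfer_replicate_zero:
  fixes w1 w2 :: "nat \<Rightarrow> nat \<Rightarrow> nat \<Rightarrow> nat \<Rightarrow> 'f::field"
  assumes st: "stable w1 w2 r" and r: "r \<noteq> 1" and ab: "a \<le> 1" "b \<le> 1"
  shows "transfer w1 w2 K empty_state a b (replicate k 0) (replicate k 0) =
    (if a = 0 \<and> b = 0 then 1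
     else if a = 1 \<and> b = 1 then column w1 w2 K 0 0 1 1 0 0 * ((1 - r ^ k) / (1 - r)) else 0)"
  using ab
proof (induction k arbitrary: a b)
  case 0
  then show ?case by (auto simp: empty_state_def)
next
  case (Suc k)
  let ?E = "column w1 w2 K 0 0"
  have bal: "?E (of_bool a) (of_bool b) (of_bool a') (of_bool b') = 0"
    if "of_bool a + of_bool b' \<noteq> (of_bool a' + of_bool b :: nat)" for a b a' b'
    using st that unfolding stable_def column_def by (intro sum.neutral) blast
  have mixed: "?E 0 0 0 1 = 0" "?E 0 0 1 0 = 0" "?E 1 1 0 1 = 0" "?E 1 1 1 0 = 0"
    "?E 0 1 0 0 = 0" "?E 0 1 1 1 = 0" "?E 1 0 0 0 = 0" "?E 1 0 1 1 = 0"
    using bal[of False True False False] bal[of False False True False] bal[of True True True False]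
      bal[of True False True True] bal[of False False False True] bal[of False True True True]
      bal[of True False False False] bal[of True True False True]
    by simp_all
  have E: "?E 0 0 0 0 = 1" "?E 1 1 1 1 = r"
    using st by (simp_all add: column_def stable_def)
  have "(\<forall>n. w1 0 0 n 1 * w2 0 0 n 1 = 0) \<or> (\<forall>n. w1 0 1 n 0 * w2 0 1 n 0 = 0)"
    using st unfolding stable_def by blast
  \<comment> \<open>An excursion from \<open>(0, 0)\<close> to \<open>(1, 1)\<close> and back
    contributes nothing, as one of its two transitions vanishes.\<close>
  then have z: "?E 0 0 1 1 = 0 \<or> ?E 1 1 0 0 = 0"
    unfolding column_def by (elim disjE) (simp_all only: sum.neutral_const simp_thms)
  have g: "1 + r * ((1 - r ^ k) / (1 - r)) = (1 - r ^ Suc k) / (1 - r)"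
    using r by (simp add: field_simps)
  have "?E 1 1 0 0 + r * (?E 1 1 0 0 * ((1 - r ^ k) / (1 - r))) =
        ?E 1 1 0 0 * ((1 - r ^ Suc k) / (1 - r))"
    by (simp only: g[symmetric] ring_distribs mult_1_right) (simp add: mult_ac)
  then have "?E 1 1 0 0 + ?E 1 1 1 1 * (?E 1 1 0 0 * ((1 - r ^ k) / (1 - r))) =
        ?E 1 1 0 0 * ((1 - r ^ Suc k) / (1 - r))"
    by (simp only: E)
  moreover have "?E 0 0 1 1 * (?E 1 1 0 0 * ((1 - r ^ k) / (1 - r))) = 0"
    using z by auto
  moreover have "a = 0 \<and> b = 0 \<or> a = 0 \<and> b = 1 \<or> a = 1 \<and> b = 0 \<or> a = 1 \<and> b = 1"
    using Suc.prems by linarith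
  ultimately show ?case
    unfolding replicate_Suc transfer.simps
    by (elim disjE) (simp_all add: Suc.IH mixed E(1) del: power_Suc of_nat_Suc One_nat_def)
qed

lemma transfer_tendsto:
  fixes w1 w2 :: "nat \<Rightarrow> nat \<Rightarrow> nat \<Rightarrow> nat \<Rightarrow> 'f::real_normed_field"
  assumes "stable w1 w2 r" and "norm r < 1" and "a \<le> 1" and "b \<le> 1" and "length ls = length ms"
  shows "(\<lambda>k. transfer w1 w2 K empty_state a b (ls @ replicate k 0) (ms @ replicate k 0))
     \<longlonglongrightarrow> transfer w1 w2 K (limit_state w1 w2 K r) a b ls ms"
  unfolding transfer_append[OF assms(5)]
proof (rule tendsto_transfer[OF _ assms(3,4)])
  fix a b :: nat
  assume ab: "a \<le> 1" "b \<le> 1"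
  have r1: "r \<noteq> 1"
    using assms(2) by auto
  have "(\<lambda>k. column w1 w2 K 0 0 1 1 0 0 * ((1 - r ^ k) / (1 - r)))
     \<longlonglongrightarrow> column w1 w2 K 0 0 1 1 0 0 * ((1 - 0) / (1 - r))"
    using r1 by (intro tendsto_intros LIMSEQ_power_zero assms(2)) auto
  then show "(\<lambda>k. transfer w1 w2 K empty_state a b (replicate k 0) (replicate k 0))
     \<longlonglongrightarrow> limit_state w1 w2 K r a b"
    unfolding transfer_replicate_zero[OF assms(1) r1 ab] limit_state_def by auto
qed

section \<open>Sums over signatures\<close>

text \<open>Multiplicative notation cut off at column \<open>t\<close>; it determines a signature
  whose parts lie in \<open>0, ..., t - 1\<close>.\<close>

definition mults :: "nat \<Rightarrow> int list \<Rightarrow> nat list" where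
  "mults t \<nu> = map (\<lambda>x. count_list \<nu> (int x)) [0..<t]"

lemma length_mults [simp]: "length (mults t \<nu>) = t"
  by (simp add: mults_def)

lemma nth_mults [simp]: "x < t \<Longrightarrow> mults t \<nu> ! x = count_list \<nu> (int x)"
  by (simp add: mults_def)

lemma mults_add:
  assumes "set \<nu> \<subseteq> {..<int t}"
  shows "mults (t + k) \<nu> = mults t \<nu> @ replicate k 0"
proof (rule nth_equalityI)
  fix x assume "x < length (mults (t + k) \<nu>)"
  moreover have "count_list \<nu> (int x) = 0" if "x \<ge> t"
    using assms that by (intro count_notin) auto
  ultimately show "mults (t + k) \<nu> ! x = (mults t \<nu> @ replicate k 0) ! x"
    by (auto simp: nth_append)
qed simp

text \<open>Finite sets that, as \<open>t\<close> grows, exhaust the nonnegative signatures with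
  multiplicities at most \<open>K\<close>, and over which the sum is a transfer product with
  \<open>t\<close> columns.\<close>

definition bounded_signatures :: "nat \<Rightarrow> nat \<Rightarrow> int list set" where
  "bounded_signatures K t =
     {\<nu> \<in> nonneg_signatures. set \<nu> \<subseteq> {..<int t} \<and> (\<forall>x. count_list \<nu> x \<le> K)}"

lemma count_concat_replicate:
  "count_list (concat (map (\<lambda>x. replicate (f x) (int x)) [0..<t])) y =
     (if 0 \<le> y \<and> y < int t then f (nat y) else 0)"
proof (induction t)
  case (Suc t)
  have "count_list (replicate n (int t)) y = (if y = int t then n else 0)" for n
    by (induction n) auto
  with Suc show ?case
    by auto
qed simp

lemma sorted_concat_replicate:
  "sorted (concat (map (\<lambda>x. replicate (f x) (int x)) [0..<t]))"
  by (induction t) (auto simp: sorted_append)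

lemma bij_betw_mults:
  "bij_betw (mults t) (bounded_signatures K t) {ns. set ns \<subseteq> {..K} \<and> length ns = t}"
  unfolding bij_betw_def
proof (intro conjI inj_onI equalityI subsetI)
  fix \<mu> \<nu> assume mu: "\<mu> \<in> bounded_signatures K t" and nu: "\<nu> \<in> bounded_signatures K t"
    and eq: "mults t \<mu> = mults t \<nu>"
  have "count (mset \<mu>) y = count (mset \<nu>) y" for y
  proof (cases "0 \<le> y \<and> y < int t")
    case True
    then show ?thesis
      using arg_cong[OF eq, of "\<lambda>xs. xs ! nat y"] by (simp add: count_mset nat_less_iff)
  next
    case False
    then have "y \<notin> set \<mu>" "y \<notin> set \<nu>"
      using mu nu by (auto simp: bounded_signatures_def nonneg_signatures_def)
    then show ?thesis
      by (simp add: count_mset)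
  qed
  then have "mset (rev \<mu>) = mset (rev \<nu>)"
    by (simp add: multiset_eq_iff)
  moreover have "sorted (rev \<mu>)" "sorted (rev \<nu>)"
    using mu nu by (simp_all add: bounded_signatures_def nonneg_signatures_def sorted_wrt_rev)
  ultimately show "\<mu> = \<nu>"
    using properties_for_sort by (metis rev_rev_ident)
next
  fix ns assume "ns \<in> mults t ` bounded_signatures K t"
  then show "ns \<in> {ns. set ns \<subseteq> {..K} \<and> length ns = t}"
    by (auto simp: bounded_signatures_def mults_def)
next
  fix ns assume ns: "ns \<in> {ns. set ns \<subseteq> {..K} \<and> length ns = t}"
  \<comment> \<open>The blocks are built by increasing part; reversal makes the list weakly
    decreasing.\<close>
  define \<nu> where "\<nu> = rev (concat (map (\<lambda>x. replicate (ns ! x) (int x)) [0..<t]))"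
  have cnt: "count_list \<nu> y = (if 0 \<le> y \<and> y < int t then ns ! nat y else 0)" for y
    by (simp add: \<nu>_def count_concat_replicate)
  have "sorted_wrt (\<ge>) \<nu>"
    using sorted_concat_replicate by (simp add: \<nu>_def sorted_wrt_rev)
  moreover have "set \<nu> \<subseteq> {0..<int t}"
    by (auto simp: \<nu>_def)
  moreover have "count_list \<nu> y \<le> K" for y
    using ns by (auto simp: cnt subset_iff)
  ultimately have "\<nu> \<in> bounded_signatures K t"
    by (auto simp: bounded_signatures_def nonneg_signatures_def)
  moreover have "ns = mults t \<nu>"
    using ns by (intro nth_equalityI) (auto simp: cnt)
  ultimately show "ns \<in> mults t ` bounded_signatures K t"
    by blast
qed

lemma finite_bounded_signatures: "finite (bounded_signatures K t)"
  using bij_betw_finite[OF bij_betw_mults] finite_lists_length_eq[of "{..K}" t] by blast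

lemma sum_bounded_signatures:
  fixes w1 w2 :: "nat \<Rightarrow> nat \<Rightarrow> nat \<Rightarrow> nat \<Rightarrow> 'f::comm_semiring_1"
  shows "(\<Sum>\<nu>\<in>bounded_signatures K t.
      row_weight w1 a (mults t lam) (mults t \<nu>) * row_weight w2 b (mults t mu) (mults t \<nu>))
    = transfer w1 w2 K empty_state a b (mults t lam) (mults t mu)"
  using sum_row_weights[of "mults t lam" "mults t mu", where K = K and ?w1.0 = w1 and ?w2.0 = w2 and a = a and b = b]
    sum.reindex_bij_betw[OF bij_betw_mults[of t K],
      of "\<lambda>ns. row_weight w1 a (mults t lam) ns * row_weight w2 b (mults t mu) ns"]
  by simp

text \<open>Sums over the exhausting finite sets are transfer products with \<open>k\<close> extra
  empty columns. With absolute values they stay bounded, which gives summability; the limit in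
  \<open>k\<close> then identifies the value.\<close>

lemma has_sum_signatures:
  fixes w1 w2 :: "nat \<Rightarrow> nat \<Rightarrow> nat \<Rightarrow> nat \<Rightarrow> complex"
  assumes stable: "stable w1 w2 r" and r: "norm r < 1" and ab: "a \<le> 1" "b \<le> 1"
    and bound: "set lam \<subseteq> {..<int t}" "set mu \<subseteq> {..<int t}"
    and f: "\<And>\<nu> k. \<nu> \<in> nonneg_signatures \<Longrightarrow> set \<nu> \<subseteq> {..<int (t + k)} \<Longrightarrow>
      f \<nu> = row_weight w1 a (mults (t + k) lam) (mults (t + k) \<nu>) *
            row_weight w2 b (mults (t + k) mu) (mults (t + k) \<nu>)"
    and f0: "\<And>\<nu>. length \<nu> > K \<Longrightarrow> f \<nu> = 0"
  shows "(f has_sum transfer w1 w2 K (limit_state w1 w2 K r) a b (mults t lam) (mults t mu))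
    nonneg_signatures"
proof -
  define D where "D k = bounded_signatures K (t + k)" for k
  define U where "U = (\<Union>k. D k)"
  let ?nw1 = "\<lambda>i j k l. norm (w1 i j k l)" and ?nw2 = "\<lambda>i j k l. norm (w2 i j k l)"
  have mono: "D k \<subseteq> D k'" if "k \<le> k'" for k k'
    using that by (auto simp: D_def bounded_signatures_def)
  have U_D: "\<exists>k. F \<subseteq> D k" if "finite F" "F \<subseteq> U" for F
    using that
  proof (induction F)
    case (insert \<nu> F)
    then obtain k k' where "F \<subseteq> D k" "\<nu> \<in> D k'"
      by (auto simp: U_def)
    then have "insert \<nu> F \<subseteq> D (max k k')"
      using mono[of k "max k k'"] mono[of k' "max k k'"] by auto
    then show ?case by blast
  qed auto
  have "(\<lambda>k. \<Sum>\<nu>\<in>D k. row_weight ?nw1 a (mults (t + k) lam) (mults (t + k) \<nu>) *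
            row_weight ?nw2 b (mults (t + k) mu) (mults (t + k) \<nu>))
     \<longlonglongrightarrow> transfer ?nw1 ?nw2 K (limit_state ?nw1 ?nw2 K (norm r)) a b (mults t lam) (mults t mu)"
    unfolding D_def sum_bounded_signatures
    unfolding mults_add[OF bound(1)] mults_add[OF bound(2)]
    using r by (intro transfer_tendsto stable_norm stable ab) auto
  \<comment> \<open>The sums of absolute values converge by the same limit theorem with ratio
    \<open>norm r\<close>, hence are bounded uniformly in \<open>k\<close>.\<close>
  from convergent_imp_Bseq[OF convergentI[OF this]] obtain M where M:
    "\<And>k. norm (\<Sum>\<nu>\<in>D k. row_weight ?nw1 a (mults (t + k) lam) (mults (t + k) \<nu>) *
            row_weight ?nw2 b (mults (t + k) mu) (mults (t + k) \<nu>)) \<le> M"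
    unfolding Bseq_def by blast
  have "sum (\<lambda>\<nu>. norm (f \<nu>)) F \<le> M" if F: "finite F" "F \<subseteq> U" for F
  proof -
    obtain k where k: "F \<subseteq> D k"
      using U_D[OF F] by blast
    have "sum (\<lambda>\<nu>. norm (f \<nu>)) F \<le> sum (\<lambda>\<nu>. norm (f \<nu>)) (D k)"
      using k by (intro sum_mono2) (auto simp: D_def finite_bounded_signatures)
    also have "\<dots> \<le> (\<Sum>\<nu>\<in>D k. row_weight ?nw1 a (mults (t + k) lam) (mults (t + k) \<nu>) *
            row_weight ?nw2 b (mults (t + k) mu) (mults (t + k) \<nu>))"
    proof (rule sum_mono)
      fix \<nu> assume "\<nu> \<in> D k"
      then have "f \<nu> = row_weight w1 a (mults (t + k) lam) (mults (t + k) \<nu>) *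
            row_weight w2 b (mults (t + k) mu) (mults (t + k) \<nu>)"
        by (intro f) (auto simp: D_def bounded_signatures_def)
      then show "norm (f \<nu>) \<le> row_weight ?nw1 a (mults (t + k) lam) (mults (t + k) \<nu>) *
            row_weight ?nw2 b (mults (t + k) mu) (mults (t + k) \<nu>)"
        unfolding norm_mult
        by (auto simp: norm_mult intro!: mult_mono norm_row_weight_le order_trans[OF norm_ge_zero norm_row_weight_le])
    qed
    also have "\<dots> \<le> M"
      using M[of k] by simp
    finally show ?thesis .
  qed
  then have "(\<lambda>\<nu>. norm (f \<nu>)) summable_on U"
    by (intro nonneg_bdd_above_summable_on) (auto simp: bdd_above_def)
  then obtain S where S: "(f has_sum S) U"
    using abs_summable_summable summable_on_def by blast
  \<comment> \<open>The sets \<open>D k\<close> eventually contain every finite subset of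
    \<open>U\<close>, so the unordered sum over \<open>U\<close> is the limit along them.\<close>
  have "filterlim D (finite_subsets_at_top U) sequentially"
    unfolding filterlim_finite_subsets_at_top
  proof (intro allI impI)
    fix X assume "finite X \<and> X \<subseteq> U"
    then obtain k where k: "X \<subseteq> D k"
      using U_D by blast
    show "eventually (\<lambda>y. finite (D y) \<and> X \<subseteq> D y \<and> D y \<subseteq> U) sequentially"
      using eventually_ge_at_top[of k]
    proof eventually_elim
      case (elim y)
      then show ?case
        using k mono[of k y] by (auto simp: U_def D_def finite_bounded_signatures)
    qed
  qed
  then have "(\<lambda>k. sum f (D k)) \<longlonglongrightarrow> S"
    using S unfolding has_sum_def by (rule filterlim_compose[rotated])
  moreover have "sum f (D k) = transfer w1 w2 K empty_state a b (mults (t + k) lam) (mults (t + k) mu)"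
    for k
    unfolding sum_bounded_signatures[symmetric] D_def
    by (intro sum.cong refl f) (auto simp: bounded_signatures_def)
  ultimately have "(\<lambda>k. transfer w1 w2 K empty_state a b (mults (t + k) lam) (mults (t + k) mu)) \<longlonglongrightarrow> S"
    by simp
  moreover have "(\<lambda>k. transfer w1 w2 K empty_state a b (mults (t + k) lam) (mults (t + k) mu))
      \<longlonglongrightarrow> transfer w1 w2 K (limit_state w1 w2 K r) a b (mults t lam) (mults t mu)"
    unfolding mults_add[OF bound(1)] mults_add[OF bound(2)]
    by (intro transfer_tendsto stable r ab) auto
  ultimately have S_eq: "S = transfer w1 w2 K (limit_state w1 w2 K r) a b (mults t lam) (mults t mu)"
    by (rule LIMSEQ_unique)
  \<comment> \<open>A signature of length at most \<open>K\<close> has multiplicities at most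
    \<open>K\<close> and bounded parts, so it lies in some \<open>D k\<close>. Outside
    \<open>U\<close> the length thus exceeds \<open>K\<close>.\<close>
  have "f \<nu> = 0" if "\<nu> \<in> nonneg_signatures - U" for \<nu>
  proof (rule f0, rule ccontr)
    assume "\<not> K < length \<nu>"
    then have "count_list \<nu> x \<le> K" for x
      using count_le_length[of \<nu> x] by linarith
    moreover obtain k where "\<forall>x\<in>set \<nu>. x \<le> int k"
      by (metis finite_set finite_nat_set_iff_bounded_le nat_le_iff finite_imageI imageI)
    then have "set \<nu> \<subseteq> {..<int (t + Suc k)}"
      by auto
    ultimately have "\<nu> \<in> D (Suc k)"
      using that by (auto simp: D_def bounded_signatures_def)
    with that show False
      by (auto simp: U_def)
  qed
  moreover have "U \<subseteq> nonneg_signatures"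
    by (auto simp: U_def D_def bounded_signatures_def)
  ultimately have "(f has_sum S) nonneg_signatures"
    using S by (subst has_sum_cong_neutral[of U nonneg_signatures f f]) auto
  then show ?thesis
    using S_eq by simp
qed

section \<open>The Yang--Baxter equation\<close>

definition mult_factor :: "complex \<Rightarrow> complex \<Rightarrow> nat \<Rightarrow> complex" where
  "mult_factor q s n = qpoch (s\<^sup>2) q n / qpoch q q n"

text \<open>The ratio of the two conjugation factors is a product over columns; absorbing one ratio
  into each vertex gives \<open>G\<^sup>c\<close> local weights.\<close>

definition conj_weight ::
    "complex \<Rightarrow> complex \<Rightarrow> complex \<Rightarrow> nat \<Rightarrow> nat \<Rightarrow> nat \<Rightarrow> nat \<Rightarrow> complex" where
  "conj_weight q s v i1 j1 i2 j2 =
     mult_factor q s i2 / mult_factor q s i1 * vertex_weight q s v i1 j1 i2 j2"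

lemma mult_factor_nonzero:
  assumes "\<And>n::nat. n \<ge> 1 \<Longrightarrow> q ^ n \<noteq> 1" and "\<And>n::nat. s\<^sup>2 * q ^ n \<noteq> 1"
  shows "mult_factor q s n \<noteq> 0"
proof -
  have "q * q ^ r \<noteq> 1" for r :: nat
    using assms(1)[of "Suc r"] by simp
  then show ?thesis
    using assms(2) by (auto simp: mult_factor_def qpoch_def)
qed

text \<open>Consecutive values of \<open>mult_factor\<close> have ratio
  \<open>(1 - s\<^sup>2 * q ^ n) / (1 - q ^ (n + 1))\<close>. Conjugation therefore interchanges
  these two factors between the turning weights and leaves the straight weights alone.\<close>

lemma conj_weight_eq:
  assumes "\<And>n::nat. n \<ge> 1 \<Longrightarrow> q ^ n \<noteq> 1" and "\<And>n::nat. s\<^sup>2 * q ^ n \<noteq> 1"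
  shows "conj_weight q s v i1 j1 i2 j2 =
     (if j1 = 0 \<and> j2 = 0 \<and> i2 = i1 then (1 - s * q ^ i1 * v) / (1 - s * v)
      else if j1 = 1 \<and> j2 = 1 \<and> i2 = i1 then (v - s * q ^ i1) / (1 - s * v)
      else if j1 = 0 \<and> j2 = 1 \<and> i1 = i2 + 1 then (1 - q ^ (i2 + 1)) * v / (1 - s * v)
      else if j1 = 1 \<and> j2 = 0 \<and> i2 = i1 + 1 then (1 - s\<^sup>2 * q ^ i1) / (1 - s * v)
      else 0)"
proof -
  note nz = mult_factor_nonzero[OF assms]
  have qn: "1 - q * q ^ n \<noteq> 0" for n
    using assms(1)[of "Suc n"] by simp
  have sn: "1 - s\<^sup>2 * q ^ n \<noteq> 0" for n
    using assms(2)[of n] by simp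
  have step: "mult_factor q s (Suc n) = mult_factor q s n * ((1 - s\<^sup>2 * q ^ n) / (1 - q * q ^ n))" for n
    by (simp add: mult_factor_def qpoch_def lessThan_Suc mult_ac)
  have up: "mult_factor q s (Suc n) / mult_factor q s n = (1 - s\<^sup>2 * q ^ n) / (1 - q * q ^ n)" for n
    using nz[of n] by (simp add: step)
  have down: "mult_factor q s n / mult_factor q s (Suc n) = (1 - q * q ^ n) / (1 - s\<^sup>2 * q ^ n)" for n
    using nz[of n] sn[of n] by (simp add: step)
  have up': "mult_factor q s (Suc n) / mult_factor q s n * ((1 - q * q ^ n) / (1 - s * v)) =
      (1 - s\<^sup>2 * q ^ n) / (1 - s * v)" for n
    unfolding up using qn[of n] by simp
  have down': "mult_factor q s n / mult_factor q s (Suc n) * ((1 - s\<^sup>2 * q ^ n) * v / (1 - s * v)) =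
      (1 - q * q ^ n) * v / (1 - s * v)" for n
    unfolding down using sn[of n] by simp
  show ?thesis
    unfolding conj_weight_def vertex_weight_def
    using nz up'[of i1] down'[of i2]
    by (auto simp del: times_divide_eq_left times_divide_eq_right)
qed

text \<open>The R-matrix of the Yang--Baxter equation, with \<open>z = u v\<close>. It is taken in the direction in
  which no division by \<open>q - u v\<close> is needed, so that \<open>u v = q\<close> is not exceptional.\<close>

definition exchange :: "complex \<Rightarrow> complex \<Rightarrow> (nat \<Rightarrow> nat \<Rightarrow> complex) \<Rightarrow> nat \<Rightarrow> nat \<Rightarrow> complex" where
  "exchange q z \<phi> a b =
     (if a \<noteq> b then (1 - q * z) * \<phi> a b
      else if a = 0 then (1 - z) * \<phi> 0 0 + (1 - q) * z * \<phi> 1 1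
      else (1 - q) * \<phi> 0 0 + q * (1 - z) * \<phi> 1 1)"

text \<open>Conservation of paths leaves the single term \<open>n = a + l - a'\<close>, which the
  bounds on \<open>l\<close> and \<open>a\<close> keep below the cut-off. The guard excludes
  truncated subtraction.\<close>

lemma column_vertex_weight:
  assumes "Suc l \<le> K" and "a \<le> 1"
  shows "column (vertex_weight q s u) w K l m a b a' b' =
    (if a' \<le> a + l then vertex_weight q s u l a (a + l - a') a' * w m b (a + l - a') b' else 0)"
proof -
  have "column (vertex_weight q s u) w K l m a b a' b' =
      (\<Sum>n\<le>K. if n = a + l - a' then (if a' \<le> a + l then vertex_weight q s u l a (a + l - a') a' * w m b (a + l - a') b' else 0) else 0)"
    unfolding column_def by (intro sum.cong refl) (auto simp: vertex_weight_def)
  then show ?thesis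
    using assms by auto
qed

lemma column_reflect_weight:
  assumes "Suc l \<le> K" and "b \<le> 1" and "b' \<le> 1"
  shows "column (reflect (conj_weight q s v)) w K l m b a b' a' =
    (if b \<le> b' + l then conj_weight q s v (b' + l - b) b l b' * w m a (b' + l - b) a' else 0)"
proof -
  have "column (reflect (conj_weight q s v)) w K l m b a b' a' =
      (\<Sum>k\<le>K. if k = b' + l - b then (if b \<le> b' + l then conj_weight q s v (b' + l - b) b l b' * w m a (b' + l - b) a' else 0) else 0)"
    unfolding column_def reflect_def conj_weight_def
    by (intro sum.cong refl) (auto simp: vertex_weight_def)
  then show ?thesis
    using assms by auto
qed

text \<open>The local Yang--Baxter equation: one column passes through the exchange matrix and turns
  into its reflection. Once conservation has removed the sums over \<open>n\<close>, it is a finite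
  set of polynomial identities.\<close>

lemma column_exchange:
  assumes gen: "\<And>n::nat. n \<ge> 1 \<Longrightarrow> q ^ n \<noteq> 1" "\<And>n::nat. s\<^sup>2 * q ^ n \<noteq> 1"
    and "Suc l \<le> K" and "a \<le> 1" and "b \<le> 1"
  shows "(\<Sum>a'\<in>{0, 1}. \<Sum>b'\<in>{0, 1}.
            column (vertex_weight q s u) (conj_weight q s v) K l m a b a' b' * exchange q (u * v) \<phi> a' b') =
         exchange q (u * v) (\<lambda>a b. \<Sum>b'\<in>{0, 1}. \<Sum>a'\<in>{0, 1}.
            column (reflect (conj_weight q s v)) (reflect (vertex_weight q s u)) K l m b a b' a' * \<phi> a' b') a b"
proof -
  \<comment> \<open>With the inverse denominators as opaque factors, only polynomial identities
    remain.\<close>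
  define iu iv where "iu = inverse (1 - s * u)" and "iv = inverse (1 - s * v)"
  have w: "vertex_weight q s u i1 j1 i2 j2 =
     (if j1 = 0 \<and> j2 = 0 \<and> i2 = i1 then (1 - s * q ^ i1 * u) * iu
      else if j1 = 1 \<and> j2 = 1 \<and> i2 = i1 then (u - s * q ^ i1) * iu
      else if j1 = 0 \<and> j2 = 1 \<and> i1 = Suc i2 then (1 - s\<^sup>2 * q ^ i2) * u * iu
      else if j1 = 1 \<and> j2 = 0 \<and> i2 = Suc i1 then (1 - q * q ^ i1) * iu
      else 0)" for i1 j1 i2 j2
    by (simp add: vertex_weight_def iu_def divide_inverse)
  have c: "conj_weight q s v i1 j1 i2 j2 =
     (if j1 = 0 \<and> j2 = 0 \<and> i2 = i1 then (1 - s * q ^ i1 * v) * iv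
      else if j1 = 1 \<and> j2 = 1 \<and> i2 = i1 then (v - s * q ^ i1) * iv
      else if j1 = 0 \<and> j2 = 1 \<and> i1 = Suc i2 then (1 - q * q ^ i2) * v * iv
      else if j1 = 1 \<and> j2 = 0 \<and> i2 = Suc i1 then (1 - s\<^sup>2 * q ^ i1) * iv
      else 0)" for i1 j1 i2 j2
    by (simp add: conj_weight_eq[OF gen] iv_def divide_inverse)
  have ab: "a = 0 \<and> b = 0 \<or> a = 0 \<and> b = 1 \<or> a = 1 \<and> b = 0 \<or> a = 1 \<and> b = 1"
    using assms(4,5) by linarith
  \<comment> \<open>Conservation in both rows makes everything vanish when \<open>l\<close> and
    \<open>m\<close> differ by more than \<open>2\<close>. Zero is split off because truncated
    subtraction and the guards behave differently there.\<close>
  have "m = l \<or> m = Suc l \<or> m = Suc (Suc l) \<or> l = Suc m \<or> l = Suc (Suc m) \<or>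
      m > Suc (Suc l) \<or> (\<exists>p. l = Suc p \<and> p > Suc m)"
    by presburger
  moreover have "l = 0 \<or> (\<exists>p. l = Suc p)" "m = 0 \<or> (\<exists>p. m = Suc p)"
    using not0_implies_Suc by blast+
  ultimately consider "m = l" "l = 0" | p where "m = l" "l = Suc p" | "m = Suc l" "l = 0" | p where "m = Suc l" "l = Suc p"
    | "m = Suc (Suc l)" "l = 0" | p where "m = Suc (Suc l)" "l = Suc p" | "l = Suc m" "m = 0" | p where "l = Suc m" "m = Suc p" | "l = Suc (Suc m)"
    | "m > Suc (Suc l)" "l = 0" | p where "m > Suc (Suc l)" "l = Suc p" | p where "l = Suc p" "p > Suc m"
    by blast
  then show ?thesis
    using ab assms(3)
    by cases (elim disjE;
        simp add: column_vertex_weight column_reflect_weight reflect_def w c exchange_def;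
        (simp add: algebra_simps power2_eq_square)?)+
qed


text \<open>The exchange matrix enters at the right end and moves through one column after another
  until it acts on the left state. The reflected product has the \<open>v\<close> row first, hence
  the swapped states.\<close>

lemma transfer_exchange:
  assumes gen: "\<And>n::nat. n \<ge> 1 \<Longrightarrow> q ^ n \<noteq> 1" "\<And>n::nat. s\<^sup>2 * q ^ n \<noteq> 1"
    and "length ls = length ms" and "\<And>l. l \<in> set ls \<Longrightarrow> Suc l \<le> K" and "a \<le> 1" and "b \<le> 1"
  shows "transfer (vertex_weight q s u) (conj_weight q s v) K (exchange q (u * v) \<phi>) a b ls ms =
    exchange q (u * v) (\<lambda>a b. transfer (reflect (conj_weight q s v)) (reflect (vertex_weight q s u)) K
       (\<lambda>b a. \<phi> a b) b a ls ms) a b"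
  using assms(3-6)
proof (induction ls ms arbitrary: a b rule: list_induct2)
  case (Cons l ls m ms)
  let ?\<psi> = "\<lambda>a b. transfer (reflect (conj_weight q s v)) (reflect (vertex_weight q s u)) K
       (\<lambda>b a. \<phi> a b) b a ls ms"
  have "transfer (vertex_weight q s u) (conj_weight q s v) K (exchange q (u * v) \<phi>) a b (l # ls) (m # ms)
    = (\<Sum>a'\<in>{0, 1}. \<Sum>b'\<in>{0, 1}. column (vertex_weight q s u) (conj_weight q s v) K l m a b a' b' *
         exchange q (u * v) ?\<psi> a' b')"
    unfolding transfer.simps using Cons.prems by (intro sum.cong refl arg_cong2[of _ _ _ _ "(*)"] Cons.IH) auto
  also have "\<dots> = exchange q (u * v) (\<lambda>a b. \<Sum>b'\<in>{0, 1}. \<Sum>a'\<in>{0, 1}.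
      column (reflect (conj_weight q s v)) (reflect (vertex_weight q s u)) K l m b a b' a' * ?\<psi> a' b') a b"
    using Cons.prems by (intro column_exchange gen) auto
  finally show ?case
    unfolding transfer.simps .
qed simp

section \<open>Collections of paths in one row\<close>

text \<open>The flag \<open>v\<close> distinguishes entry from below and from the left;
  \<open>a\<close> and \<open>b\<close> are the first and last columns visited in row
  \<open>1\<close>.\<close>

definition row_path :: "bool \<Rightarrow> int \<Rightarrow> int \<Rightarrow> path" where
  "row_path v a b = (if v then (a, 0) else (a - 1, 1)) # map (\<lambda>x. (x, 1)) [a..b] @ [(b, 2)]"

lemma length_row_path: "a \<le> b \<Longrightarrow> length (row_path v a b) = nat (b - a) + 3"
  by (simp add: row_path_def)

lemma nth_row_path:
  assumes "a \<le> b" and "i < nat (b - a) + 3"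
  shows "row_path v a b ! i =
    (if i = 0 then (if v then (a, 0) else (a - 1, 1))
     else if i = nat (b - a) + 2 then (b, 2) else (a + int i - 1, 1))"
  using assms by (cases i) (auto simp: row_path_def nth_append)

lemma up_right_row_path: "a \<le> b \<Longrightarrow> up_right_path (row_path v a b)"
  unfolding up_right_path_def by (auto simp: length_row_path nth_row_path)

lemma first_edge_row_path: "a \<le> b \<Longrightarrow> first_edge (row_path v a b) = (if v then (a, 0) else (a - 1, 1), (a, 1))"
  by (simp add: first_edge_def nth_row_path)

lemma last_edge_row_path: "a \<le> b \<Longrightarrow> last_edge (row_path v a b) = ((b, 1), (b, 2))"
  by (simp add: last_edge_def nth_row_path length_row_path)

lemma path_interior_row_path: "a \<le> b \<Longrightarrow> path_interior (row_path v a b) = {a..b} \<times> {1}"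
  by (auto simp: path_interior_def row_path_def)

lemma path_edges_row_path:
  assumes "a \<le> b"
  shows "path_edges (row_path v a b) =
    {(if v then (a, 0) else (a - 1, 1), (a, 1)), ((b, 1), (b, 2))} \<union> (\<lambda>x. ((x, 1), (x + 1, 1))) ` {a..<b}"
proof (intro equalityI subsetI)
  fix e :: edge assume "e \<in> path_edges (row_path v a b)"
  then obtain i where i: "Suc i < nat (b - a) + 3" and e: "e = (row_path v a b ! i, row_path v a b ! Suc i)"
    by (auto simp: path_edges_def length_row_path assms)
  consider "i = 0" | "i = nat (b - a) + 1" | "i > 0" "i < nat (b - a) + 1"
    using i by linarith
  then show "e \<in> {(if v then (a, 0) else (a - 1, 1), (a, 1)), ((b, 1), (b, 2))} \<union>
      (\<lambda>x. ((x, 1), (x + 1, 1))) ` {a..<b}"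
  proof cases
    case 3
    then have "e = (\<lambda>x. ((x, 1), (x + 1, 1))) (a + int i - 1)" "a + int i - 1 \<in> {a..<b}"
      using assms by (auto simp: e nth_row_path)
    then show ?thesis by blast
  qed (use assms in \<open>auto simp: e nth_row_path\<close>)
next
  fix e :: edge assume "e \<in> {(if v then (a, 0) else (a - 1, 1), (a, 1)), ((b, 1), (b, 2))} \<union>
      (\<lambda>x. ((x, 1), (x + 1, 1))) ` {a..<b}"
  then consider "e = (if v then (a, 0) else (a - 1, 1), (a, 1))" | "e = ((b, 1), (b, 2))"
    | x where "e = ((x, 1), (x + 1, 1))" "a \<le> x" "x < b"
    by auto
  then have "\<exists>i. e = (row_path v a b ! i, row_path v a b ! Suc i) \<and> Suc i < nat (b - a) + 3"
  proof cases
    case 1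
    then show ?thesis using assms by (intro exI[of _ 0]) (auto simp: nth_row_path)
  next
    case 2
    then show ?thesis using assms by (intro exI[of _ "nat (b - a) + 1"]) (auto simp: nth_row_path)
  next
    case 3
    then show ?thesis using assms by (intro exI[of _ "nat (x - a) + 1"]) (auto simp: nth_row_path)
  qed
  then show "e \<in> path_edges (row_path v a b)"
    using assms by (auto simp: path_edges_def length_row_path)
qed

lemma up_right_path_mono:
  assumes "up_right_path p" and "i \<le> j" and "j < length p"
  shows "snd (p ! i) \<le> snd (p ! j)"
  using assms(2,3)
proof (induction j rule: dec_induct)
  case (step n)
  then show ?case
    using assms(1) unfolding up_right_path_def by force
qed simp

text \<open>Heights never decrease along a path. Height \<open>1\<close> after the first edge and
  before the last one makes every step in between horizontal.\<close>

lemma path_is_row_path: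
  assumes p: "up_right_path p" and first: "first_edge p = (if v then (a, 0) else (a - 1, 1), (a, 1))"
    and last: "last_edge p = ((b, 1), (b, 2))" and "v \<or> a \<le> b"
  shows "a \<le> b \<and> p = row_path v a b"
proof -
  define n where "n = length p"
  have n2: "n \<ge> 2" and nxt: "\<And>i. Suc i < n \<Longrightarrow>
      p ! Suc i = (fst (p ! i) + 1, snd (p ! i)) \<or> p ! Suc i = (fst (p ! i), snd (p ! i) + 1)"
    using p by (auto simp: up_right_path_def n_def)
  have ends: "p ! 0 = (if v then (a, 0) else (a - 1, 1))" "p ! 1 = (a, 1)" "p ! (n - 2) = (b, 1)"
    "p ! (n - 1) = (b, 2)"
    using first last by (auto simp: first_edge_def last_edge_def n_def)
  \<comment> \<open>With two vertices the first and last edge would coincide, but they end at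
    heights \<open>1\<close> and \<open>2\<close>.\<close>
  have "n \<noteq> 2"
    using ends by (auto)
  then have n3: "n \<ge> 3"
    using n2 by linarith
  have mid: "p ! i = (a + int i - 1, 1)" if "i \<ge> 1" "i \<le> n - 2" for i
    using that
  proof (induction i rule: dec_induct)
    case base
    then show ?case using ends by simp
  next
    case (step m)
    then have i: "p ! m = (a + int m - 1, 1)" by simp
    have "snd (p ! Suc m) \<le> snd (p ! (n - 2))"
      using step n3 by (intro up_right_path_mono p) (auto simp: n_def)
    then have "snd (p ! Suc m) \<le> 1"
      by (simp add: ends)
    moreover have "Suc m < n"
      using step.prems n3 by linarith
    ultimately show ?case
      using nxt[of m] i by auto
  qed
  have b: "b = a + int (n - 2) - 1"
    using mid[of "n - 2"] ends n3 by simp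
  then have ab: "a \<le> b" and n: "n = nat (b - a) + 3"
    using n3 by auto
  have "p = row_path v a b"
  proof (rule nth_equalityI)
    show "length p = length (row_path v a b)"
      using n ab by (simp add: length_row_path n_def)
    fix i assume "i < length p"
    then consider "i = 0" | "i = n - 1" | "i \<ge> 1" "i \<le> n - 2"
      by (fastforce simp: n_def)
    then show "p ! i = row_path v a b ! i"
      using ab n3 ends mid[of i] by cases (auto simp: nth_row_path n)
  qed
  with ab show ?thesis by simp
qed

section \<open>Conservation of paths along a row\<close>

definition path_preserving :: "(nat \<Rightarrow> nat \<Rightarrow> nat \<Rightarrow> nat \<Rightarrow> 'f::zero) \<Rightarrow> bool" where
  "path_preserving w \<longleftrightarrow> (\<forall>i1 j1 i2 j2. w i1 j1 i2 j2 \<noteq> 0 \<longrightarrow> i1 + j1 = i2 + j2 \<and> j2 \<le> 1)"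

lemma path_preserving_vertex_weight: "path_preserving (vertex_weight q s u)"
  by (auto simp: path_preserving_def vertex_weight_def split: if_splits)

text \<open>Conservation determines each horizontal number from the previous one, so every sum in
  \<open>row_weight\<close> has at most one nonzero term.\<close>

lemma row_weight_eq_prod:
  assumes w: "path_preserving w"
    and "length ls = length ns" and "\<And>x. x < length ls \<Longrightarrow> ls ! x + j x = ns ! x + j (Suc x)"
    and "j (length ls) = 0"
  shows "row_weight w (j 0) ls ns = (\<Prod>x<length ls. w (ls ! x) (j x) (ns ! x) (j (Suc x)))"
  using assms(2-4)
proof (induction ls ns arbitrary: j rule: list_induct2)
  case (Cons l ls n ns)
  have "row_weight w (j (Suc 0)) ls ns =
      (\<Prod>x<length ls. w (ls ! x) (j (Suc x)) (ns ! x) (j (Suc (Suc x))))"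
    using Cons.prems(1)[of "Suc x" for x] Cons.prems(2) by (intro Cons.IH) auto
  moreover have l: "l + j 0 = n + j (Suc 0)"
    using Cons.prems(1)[of 0] by simp
  have zero: "w l (j 0) n a' = 0" if "a' \<noteq> j (Suc 0)" for a'
    using w l that by (fastforce simp: path_preserving_def)
  have "(\<Sum>a'\<in>{0, 1}. w l (j 0) n a' * row_weight w a' ls ns) =
      w l (j 0) n (j (Suc 0)) * row_weight w (j (Suc 0)) ls ns"
  proof (cases "j (Suc 0) \<le> 1")
    case True
    then have "j (Suc 0) = 0 \<or> j (Suc 0) = 1" by linarith
    then show ?thesis using zero[of 0] zero[of 1] by auto
  next
    case False
    \<comment> \<open>A horizontal number above \<open>1\<close> is not summed over, but its weight
      is zero as well, so both sides vanish.\<close>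
    then have "w l (j 0) n (j (Suc 0)) = 0"
      using w by (auto simp: path_preserving_def)
    then show ?thesis using zero[of 0] zero[of 1] False by auto
  qed
  ultimately show ?case
    by (simp only: row_weight.simps list.size add_Suc_right add_0_right prod.lessThan_Suc_shift
        nth_Cons_0 nth_Cons_Suc)
qed simp

text \<open>Selecting a nonzero term of each sum from left to right yields the horizontal occupation
  numbers.\<close>

lemma row_weight_nonzero:
  assumes w: "path_preserving w"
    and "row_weight w a ls ns \<noteq> 0" and "length ls = length ns"
  shows "\<exists>j. j 0 = a \<and> j (length ls) = 0 \<and> (\<forall>x<length ls. ls ! x + j x = ns ! x + j (Suc x))"
  using assms(3,2)
proof (induction ls ns arbitrary: a rule: list_induct2)
  case Nil
  then show ?case by (intro exI[of _ "\<lambda>_. 0"]) (auto split: if_splits)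
next
  case (Cons l ls n ns)
  then obtain a' where "w l a n a' * row_weight w a' ls ns \<noteq> 0"
    unfolding row_weight.simps by (meson sum.neutral)
  then have "w l a n a' \<noteq> 0" "row_weight w a' ls ns \<noteq> 0"
    by auto
  then have l: "l + a = n + a'" and "row_weight w a' ls ns \<noteq> 0"
    using w by (auto simp: path_preserving_def)
  with Cons.IH obtain j where j: "j 0 = a'" "j (length ls) = 0"
    "\<forall>x<length ls. ls ! x + j x = ns ! x + j (Suc x)"
    by blast
  have "(l # ls) ! x + case_nat a j x = (n # ns) ! x + case_nat a j (Suc x)" if "x < length (l # ls)" for x
    using that l j by (cases x) auto
  then show ?case
    using j by (intro exI[of _ "case_nat a j"]) auto
qed

section \<open>Occupation numbers of a one-row collection\<close>

lemma count_vertical_edges: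
  "count_list (vertical_edges y \<nu>) ((x, y'), (x, y'')) =
     (if y' = y \<and> y'' = y + 1 then count_list \<nu> x else 0)"
  by (induction \<nu>) (auto simp: vertical_edges_def)

lemma count_vertical_edges_left: "count_list (vertical_edges y \<nu>) ((x - 1, y'), (x, y'')) = 0"
  by (induction \<nu>) (auto simp: vertical_edges_def)

lemma left_edges_01: "left_edges 0 = []" "left_edges (Suc 0) = [((-1, 1), (0, 1))]"
  by (simp_all add: left_edges_def)

lemma count_image_mset_size: "count (image_mset f C) e = size {#p \<in># C. f p = e#}"
  by (induction C) auto

text \<open>With \<open>f\<close> the first or the last edge, this reads the occupation numbers of
  the outer edges off the prescribed starts and ends.\<close>

lemma edge_count_image:
  assumes "\<And>p. p \<in># C \<Longrightarrow> e \<in> path_edges p \<longleftrightarrow> f p = e"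
  shows "edge_count C e = count (image_mset f C) e"
  unfolding edge_count_def count_image_mset_size
  by (intro arg_cong[of _ _ size] filter_mset_cong refl assms)

lemma edge_count_eq_0_iff: "edge_count C e = 0 \<longleftrightarrow> (\<forall>p\<in>#C. e \<notin> path_edges p)"
  unfolding edge_count_def by (induction C) auto

lemma edge_count_sum: "edge_count C e = (\<Sum>p\<in>#C. of_bool (e \<in> path_edges p))"
  unfolding edge_count_def by (induction C) auto

abbreviation row_starts :: "nat \<Rightarrow> int list \<Rightarrow> edge list" where
  "row_starts k \<mu> \<equiv> vertical_edges 0 \<mu> @ left_edges k"

lemma row_collection_member:
  assumes C: "C \<in> collections (row_starts k \<mu>) (vertical_edges 1 \<nu>)" and p: "p \<in># C"
    and k: "k \<le> 1" and nonneg: "\<mu> \<in> nonneg_signatures" "\<nu> \<in> nonneg_signatures"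
  obtains v a b where "v \<or> a = 0" "0 \<le> a" "a \<le> b" "b \<in> set \<nu>" "p = row_path v a b"
proof -
  have "last_edge p \<in># image_mset last_edge C" "first_edge p \<in># image_mset first_edge C"
    using p by auto
  then have "last_edge p \<in> set (vertical_edges 1 \<nu>)" "first_edge p \<in> set (row_starts k \<mu>)"
    using C by (simp_all only: collections_def mem_Collect_eq set_mset_mset)
  then obtain b where b: "b \<in> set \<nu>" "last_edge p = ((b, 1), (b, 2))"
    and first: "(\<exists>a\<in>set \<mu>. first_edge p = ((a, 0), (a, 1))) \<or> first_edge p = ((-1, 1), (0, 1))"
    using k by (cases k) (auto simp: vertical_edges_def left_edges_01)
  have up: "up_right_path p"
    using C p by (auto simp: collections_def)
  from first show thesis
  proof (elim disjE bexE)
    fix a assume a: "a \<in> set \<mu>" "first_edge p = ((a, 0), (a, 1))"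
    then show thesis
      using path_is_row_path[OF up _ b(2), of True a] nonneg b(1) that[of True a b]
      by (auto simp: nonneg_signatures_def)
  next
    assume "first_edge p = ((-1, 1), (0, 1))"
    then show thesis
      using path_is_row_path[OF up _ b(2), of False 0] nonneg b(1) that[of False 0 b]
      by (auto simp: nonneg_signatures_def)
  qed
qed

text \<open>Occupation of the horizontal edge into column \<open>x\<close>: paths started to its
  left minus paths already ended. When a collection exists, the difference is not truncated.\<close>

definition flux :: "nat \<Rightarrow> int list \<Rightarrow> int list \<Rightarrow> nat \<Rightarrow> nat" where
  "flux k \<mu> \<nu> x = k + (\<Sum>y<x. count_list \<mu> (int y)) - (\<Sum>y<x. count_list \<nu> (int y))"

lemma flux_unique:
  fixes j :: "nat \<Rightarrow> nat"
  assumes "j 0 = k" and "\<And>y. y < x \<Longrightarrow> count_list \<mu> (int y) + j y = count_list \<nu> (int y) + j (Suc y)"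
  shows "j x + (\<Sum>y<x. count_list \<nu> (int y)) = k + (\<Sum>y<x. count_list \<mu> (int y))"
  using assms(2)
proof (induction x)
  case (Suc x)
  then have "j x + (\<Sum>y<x. count_list \<nu> (int y)) = k + (\<Sum>y<x. count_list \<mu> (int y))"
    by simp
  then show ?case
    using Suc.prems[of x] by simp
qed (use assms(1) in simp)

definition row_configuration :: "nat \<Rightarrow> int list \<Rightarrow> int list \<Rightarrow> configuration" where
  "row_configuration k \<mu> \<nu> = (\<lambda>(x, y).
     if y = 1 \<and> x \<ge> 0 \<and> count_list \<mu> x + flux k \<mu> \<nu> (nat x) > 0
     then Some (count_list \<mu> x, flux k \<mu> \<nu> (nat x), count_list \<nu> x, flux k \<mu> \<nu> (Suc (nat x)))
     else None)"

text \<open>The starts and ends fix all vertical numbers, and conservation at each vertex then fixes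
  the horizontal ones. All collections are thus identified.\<close>

lemma row_collection:
  assumes C: "C \<in> collections (row_starts k \<mu>) (vertical_edges 1 \<nu>)"
    and k: "k \<le> 1" and nonneg: "\<mu> \<in> nonneg_signatures" "\<nu> \<in> nonneg_signatures"
  shows "configuration_of C = row_configuration k \<mu> \<nu>"
    and "count_list \<mu> (int x) + flux k \<mu> \<nu> x = count_list \<nu> (int x) + flux k \<mu> \<nu> (Suc x)"
    and "set \<nu> \<subseteq> {..<int t} \<Longrightarrow> flux k \<mu> \<nu> t = 0"
proof -
  note member = row_collection_member[OF C _ k nonneg]
  have starts: "image_mset first_edge C = mset (row_starts k \<mu>)"
    and ends: "image_mset last_edge C = mset (vertical_edges 1 \<nu>)"
    using C by (auto simp: collections_def)
  define j where "j x = edge_count C ((int x - 1, 1), (int x, 1))" for x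
  have south: "edge_count C ((x, 0), (x, 1)) = count_list \<mu> x" for x
  proof -
    have "edge_count C ((x, 0), (x, 1)) = count (image_mset first_edge C) ((x, 0), (x, 1))"
      by (rule edge_count_image, erule member) (auto simp: path_edges_row_path first_edge_row_path)
    then show ?thesis
      using k by (cases k) (auto simp: starts count_mset count_vertical_edges left_edges_01)
  qed
  have north: "edge_count C ((x, 1), (x, 2)) = count_list \<nu> x" for x
  proof -
    have "edge_count C ((x, 1), (x, 2)) = count (image_mset last_edge C) ((x, 1), (x, 2))"
      by (rule edge_count_image, erule member) (auto simp: path_edges_row_path last_edge_row_path)
    then show ?thesis
      by (simp add: ends count_mset count_vertical_edges)
  qed
  have j0: "j 0 = k"
  proof -
    have "j 0 = count (image_mset first_edge C) ((- 1, 1), (0, 1))"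
      unfolding j_def of_nat_0 diff_0
      by (rule edge_count_image, erule member) (auto simp: path_edges_row_path first_edge_row_path)
    then show ?thesis
      using k count_vertical_edges_left[of 0 \<mu> 0 1 1]
      by (cases k) (auto simp: starts count_mset left_edges_01)
  qed
  \<comment> \<open>Each single path enters and leaves a vertex of the row equally often; summing
    over the paths gives conservation.\<close>
  have flow: "edge_count C ((x, 0), (x, 1)) + edge_count C ((x - 1, 1), (x, 1)) =
      edge_count C ((x, 1), (x, 2)) + edge_count C ((x, 1), (x + 1, 1))" if "x \<ge> 0" for x
    unfolding edge_count_sum sum_mset.distrib[symmetric]
    by (intro arg_cong[of _ _ sum_mset] image_mset_cong, erule member)
      (use that in \<open>auto simp: path_edges_row_path image_iff of_bool_def\<close>)
  have step: "count_list \<mu> (int x) + j x = count_list \<nu> (int x) + j (Suc x)" for x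
    using flow[of "int x"] by (simp add: j_def south north add_ac)
  have flux: "flux k \<mu> \<nu> x = j x" for x
    using flux_unique[of j k x \<mu> \<nu>] j0 step by (simp add: flux_def)
  show "count_list \<mu> (int x) + flux k \<mu> \<nu> x = count_list \<nu> (int x) + flux k \<mu> \<nu> (Suc x)"
    by (simp add: flux step)
  show "flux k \<mu> \<nu> t = 0" if "set \<nu> \<subseteq> {..<int t}"
  proof -
    have "((int t - 1, 1), (int t, 1)) \<notin> path_edges p" if "p \<in># C" for p
      using that by (rule member) (use \<open>set \<nu> \<subseteq> {..<int t}\<close> in \<open>auto simp: path_edges_row_path subset_iff\<close>)
    then show ?thesis
      unfolding flux j_def edge_count_eq_0_iff by blast
  qed
  have int_iff: "(x, y) \<in> interior_vertices C \<longleftrightarrow> y = 1 \<and> x \<ge> 0 \<and> count_list \<mu> x + j (nat x) > 0" for x y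
  proof -
    have "(x, y) \<in> interior_vertices C \<longleftrightarrow> (\<exists>p\<in>#C. (x, y) \<in> path_interior p)"
      by (simp add: interior_vertices_def)
    also have "\<dots> \<longleftrightarrow> (\<exists>p\<in>#C. y = 1 \<and> x \<ge> 0 \<and>
        (((x, 0), (x, 1)) \<in> path_edges p \<or> ((x - 1, 1), (x, 1)) \<in> path_edges p))"
      by (intro bex_cong refl, erule member) (auto simp: path_edges_row_path path_interior_row_path image_iff)
    also have "\<dots> \<longleftrightarrow> y = 1 \<and> x \<ge> 0 \<and> (edge_count C ((x, 0), (x, 1)) > 0 \<or> edge_count C ((x - 1, 1), (x, 1)) > 0)"
      by (auto simp: edge_count_eq_0_iff zero_less_iff_neq_zero)
    also have "\<dots> \<longleftrightarrow> y = 1 \<and> x \<ge> 0 \<and> count_list \<mu> x + j (nat x) > 0"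
      by (auto simp: j_def south)
    finally show ?thesis .
  qed
  show "configuration_of C = row_configuration k \<mu> \<nu>"
  proof
    fix z :: vertex
    obtain x y where z: "z = (x, y)" by force
    show "configuration_of C z = row_configuration k \<mu> \<nu> z"
      unfolding z configuration_of_def row_configuration_def prod.case int_iff flux
      by (auto simp: south north j_def add_ac)
  qed
qed

section \<open>Existence of a collection\<close>

lemma length_filter_less:
  assumes "\<forall>y\<in>set \<nu>. 0 \<le> y"
  shows "length (filter (\<lambda>y. y < int x) \<nu>) = (\<Sum>y<x. count_list \<nu> (int y))"
proof (induction x)
  case 0
  then show ?case using assms by (auto simp: filter_empty_conv)
next
  case (Suc x)
  have "length (filter (\<lambda>y. y < int (Suc x)) \<nu>) = length (filter (\<lambda>y. y < int x) \<nu>) + count_list \<nu> (int x)"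
    by (induction \<nu>) auto
  with Suc show ?case by simp
qed

text \<open>Matching the starts with the ends in decreasing order gives a collection as soon as no
  horizontal edge would have to be occupied a negative number of times.\<close>

lemma row_collection_exists:
  assumes k: "k \<le> 1" and nonneg: "\<mu> \<in> nonneg_signatures" "\<nu> \<in> nonneg_signatures"
    and bounds: "set \<mu> \<subseteq> {..<int t}" "set \<nu> \<subseteq> {..<int t}"
    and le: "\<And>x. x \<le> t \<Longrightarrow> (\<Sum>y<x. count_list \<nu> (int y)) \<le> k + (\<Sum>y<x. count_list \<mu> (int y))"
    and eq: "(\<Sum>y<t. count_list \<nu> (int y)) = k + (\<Sum>y<t. count_list \<mu> (int y))"
  shows "collections (row_starts k \<mu>) (vertical_edges 1 \<nu>) \<noteq> {}"
proof -
  \<comment> \<open>The starting columns in decreasing order; a path from the left boundary starts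
    in column \<open>0\<close> and can come last.\<close>
  define as where "as = \<mu> @ replicate k 0"
  have pos: "\<forall>y\<in>set \<mu>. 0 \<le> y" "\<forall>y\<in>set \<nu>. 0 \<le> y"
    using nonneg by (auto simp: nonneg_signatures_def)
  note cnt = length_filter_less[OF pos(1)] length_filter_less[OF pos(2)]
  have "filter (\<lambda>y. y < int t) \<mu> = \<mu>" "filter (\<lambda>y. y < int t) \<nu> = \<nu>"
    using bounds by (auto simp: filter_id_conv)
  then have len: "length \<nu> = length \<mu> + k"
    using eq cnt[of t] by simp
  then have len_as: "length as = length \<nu>"
    by (simp add: as_def)
  have sorted: "sorted_wrt (\<ge>) as" "sorted_wrt (\<ge>) \<nu>"
    using nonneg k by (cases k; auto simp: as_def nonneg_signatures_def sorted_wrt_append)+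
  have match: "as ! i \<le> \<nu> ! i" if i: "i < length \<nu>" for i
  proof (rule ccontr)
    assume "\<not> as ! i \<le> \<nu> ! i"
    then have lt: "\<nu> ! i < as ! i" by simp
    \<comment> \<open>All ends from index \<open>i\<close> on lie left of this column, while the
      starts up to index \<open>i\<close> do not. More ends than starts would then lie left of
      \<open>x\<close>, against \<open>le\<close>.\<close>
    define x where "x = nat (as ! i)"
    have "0 \<le> \<nu> ! i"
      using pos i by auto
    then have x: "int x = as ! i" "x > 0"
      using lt by (auto simp: x_def)
    have "as ! i \<in> set as"
      using i len_as by (intro nth_mem) auto
    then have "x \<le> t"
      using x bounds(1) by (auto simp: as_def split: if_splits)
    have "length (filter (\<lambda>y. y < int x) (take i \<nu>)) + length (drop i \<nu>)
        \<le> length (filter (\<lambda>y. y < int x) (take i \<nu> @ drop i \<nu>))"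
    proof -
      have "filter (\<lambda>y. y < int x) (drop i \<nu>) = drop i \<nu>"
      proof (rule filter_True, rule ballI)
        fix y assume "y \<in> set (drop i \<nu>)"
        then obtain m where "m < length \<nu> - i" "y = \<nu> ! (i + m)"
          by (auto simp: in_set_conv_nth)
        then have "y \<le> \<nu> ! i"
          using sorted_wrt_nth_less[OF sorted(2), of i "i + m"] i by (cases m) auto
        then show "y < int x"
          using lt x by simp
      qed
      then show ?thesis
        unfolding filter_append by simp
    qed
    then have "length \<nu> - i \<le> length (filter (\<lambda>y. y < int x) \<nu>)"
      by simp
    moreover have "length (filter (\<lambda>y. y < int x) as) < length \<nu> - i"
    proof -
      have "filter (\<lambda>y. y < int x) (take (Suc i) as) = []"
        unfolding filter_empty_conv
      proof
        fix y assume "y \<in> set (take (Suc i) as)"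
        then obtain m where "m < length (take (Suc i) as)" "y = take (Suc i) as ! m"
          unfolding in_set_conv_nth by blast
        then have "m \<le> i" "m < length as" "y = as ! m"
          by simp_all
        moreover have "i < length as"
          using i len_as by simp
        ultimately have "as ! i \<le> y"
          using sorted_wrt_nth_less[OF sorted(1), of m i] by (cases "m = i") auto
        then show "\<not> y < int x"
          using x by simp
      qed
      then have "length (filter (\<lambda>y. y < int x) (take (Suc i) as @ drop (Suc i) as))
          \<le> length (drop (Suc i) as)"
        unfolding filter_append by (simp del: length_drop)
      then show ?thesis
        using i len_as unfolding append_take_drop_id by simp
    qed
    moreover have "length (filter (\<lambda>y. y < int x) as) = k + length (filter (\<lambda>y. y < int x) \<mu>)"
      using x(2) by (simp add: as_def)
    ultimately show False
      using le[OF \<open>x \<le> t\<close>] by (simp add: cnt)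
  qed
  define P where "P i = row_path (i < length \<mu>) (as ! i) (\<nu> ! i)" for i
  let ?C = "mset (map P [0..<length \<nu>])"
  have first: "first_edge (P i) = (if i < length \<mu> then (as ! i, 0) else (as ! i - 1, 1), (as ! i, 1))"
    if "i < length \<nu>" for i
    using match[OF that] by (simp add: P_def first_edge_row_path)
  have "map first_edge (map P [0..<length \<nu>]) = row_starts k \<mu>"
    using k len by (cases k)
      (auto intro!: nth_equalityI simp: first as_def nth_append vertical_edges_def left_edges_01)
  moreover have "map last_edge (map P [0..<length \<nu>]) = vertical_edges 1 \<nu>"
    by (intro nth_equalityI) (auto simp: P_def last_edge_row_path match vertical_edges_def)
  ultimately have "image_mset first_edge ?C = mset (row_starts k \<mu>)"
    "image_mset last_edge ?C = mset (vertical_edges 1 \<nu>)"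
    by (metis mset_map)+
  moreover have "\<forall>p\<in>#?C. up_right_path p"
    by (auto simp: P_def intro!: up_right_row_path match)
  ultimately show ?thesis
    unfolding collections_def by blast
qed

text \<open>At most one configuration exists. If there is none, the row weight vanishes as well;
  otherwise both sides are the product of its vertex weights.\<close>

lemma partition_function_row:
  assumes k: "k \<le> 1" and nonneg: "\<mu> \<in> nonneg_signatures" "\<nu> \<in> nonneg_signatures"
    and bounds: "set \<mu> \<subseteq> {..<int t}" "set \<nu> \<subseteq> {..<int t}" and u: "1 - s * u \<noteq> 0"
  shows "partition_function q s [u] (row_starts k \<mu>) (vertical_edges 1 \<nu>) =
    row_weight (vertex_weight q s u) k (mults t \<mu>) (mults t \<nu>)"
proof (cases "collections (row_starts k \<mu>) (vertical_edges 1 \<nu>) = {}")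
  case True
  have "row_weight (vertex_weight q s u) k (mults t \<mu>) (mults t \<nu>) = 0"
  proof (rule ccontr)
    assume "row_weight (vertex_weight q s u) k (mults t \<mu>) (mults t \<nu>) \<noteq> 0"
    then obtain j where j: "j 0 = k" "j t = 0"
      "\<forall>x<t. count_list \<mu> (int x) + j x = count_list \<nu> (int x) + j (Suc x)"
      using row_weight_nonzero[OF path_preserving_vertex_weight[of q s u], where ls = "mults t \<mu>" and ns = "mults t \<nu>"] by auto
    have "j x + (\<Sum>y<x. count_list \<nu> (int y)) = k + (\<Sum>y<x. count_list \<mu> (int y))" if "x \<le> t" for x
      using j that by (intro flux_unique) auto
    from row_collection_exists[OF k nonneg bounds] this this[of t] j(2) True show False
      by (metis add_0 le_add2 order_refl)
  qed
  with True show ?thesis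
    by (simp add: partition_function_def)
next
  case False
  then obtain C where C: "C \<in> collections (row_starts k \<mu>) (vertical_edges 1 \<nu>)" by blast
  let ?j = "flux k \<mu> \<nu>"
  let ?w = "\<lambda>x. vertex_weight q s u (count_list \<mu> (int x)) (?j x) (count_list \<nu> (int x)) (?j (Suc x))"
  note step = row_collection(2)[OF C k nonneg]
  have jt: "?j t = 0"
    by (rule row_collection(3)[OF C k nonneg bounds(2)])
  have "configuration_of ` collections (row_starts k \<mu>) (vertical_edges 1 \<nu>) =
      (\<lambda>_. row_configuration k \<mu> \<nu>) ` collections (row_starts k \<mu>) (vertical_edges 1 \<nu>)"
    by (intro image_cong refl row_collection(1)[OF _ k nonneg])
  also have "\<dots> = {row_configuration k \<mu> \<nu>}"
    by (rule image_constant[OF C])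
  finally have "partition_function q s [u] (row_starts k \<mu>) (vertical_edges 1 \<nu>) =
      configuration_weight q s [u] (row_configuration k \<mu> \<nu>)"
    by (simp add: partition_function_def)
  also have "\<dots> = (\<Prod>x<t. ?w x)"
  proof -
    let ?X = "{x. x < t \<and> count_list \<mu> (int x) + ?j x > 0}"
    \<comment> \<open>Nothing starts from column \<open>t\<close> on, so conservation propagates
      emptiness.\<close>
    have zero: "?j x = 0" if "x \<ge> t" for x
      using that
    proof (induction x rule: dec_induct)
      case (step x)
      have "count_list \<mu> (int x) = 0"
        using bounds(1) step.hyps by (intro count_notin) auto
      with \<open>\<And>x. count_list \<mu> (int x) + ?j x = count_list \<nu> (int x) + ?j (Suc x)\<close>[of x] step.IH
      show ?case by simp
    qed (rule jt)
    have column_less: "x < int t" if "count_list \<mu> x + ?j (nat x) > 0" for x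
    proof (rule ccontr)
      assume "\<not> x < int t"
      then have "count_list \<mu> x = 0" "?j (nat x) = 0"
        using bounds(1) zero[of "nat x"] by (auto intro!: count_notin)
      with that show False by simp
    qed
    have dom: "dom (row_configuration k \<mu> \<nu>) = (\<lambda>x. (int x, 1)) ` ?X"
    proof (intro equalityI subsetI)
      fix z assume z: "z \<in> dom (row_configuration k \<mu> \<nu>)"
      obtain x y where xy: "z = (x, y)" by force
      with z have "y = 1" "x \<ge> 0" "count_list \<mu> x + ?j (nat x) > 0"
        by (auto simp: row_configuration_def split: if_splits)
      moreover from this(3) have "x < int t"
        by (rule column_less)
      ultimately have "z = (int (nat x), 1)" "nat x \<in> ?X"
        by (simp_all add: xy nat_less_iff)
      then show "z \<in> (\<lambda>x. (int x, 1)) ` ?X" by blast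
    qed (auto simp: row_configuration_def)
    have "configuration_weight q s [u] (row_configuration k \<mu> \<nu>) = (\<Prod>x\<in>?X. ?w x)"
      unfolding configuration_weight_def dom
      by (subst prod.reindex) (auto simp: inj_on_def row_configuration_def intro!: prod.cong)
    also have "\<dots> = (\<Prod>x<t. ?w x)"
    proof (rule prod.mono_neutral_left)
      \<comment> \<open>A vertex that no path enters has all four numbers zero, and its weight is
        \<open>1\<close> because \<open>1 - s * u\<close> is nonzero.\<close>
      show "\<forall>x\<in>{..<t} - ?X. ?w x = 1"
      proof
        fix x assume "x \<in> {..<t} - ?X"
        then have "count_list \<mu> (int x) = 0" "?j x = 0" by auto
        with step[of x] u show "?w x = 1"
          by (simp add: vertex_weight_def)
      qed
    qed auto
    finally show ?thesis .
  qed
  also have "\<dots> = row_weight (vertex_weight q s u) (?j 0) (mults t \<mu>) (mults t \<nu>)"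
    using row_weight_eq_prod[OF path_preserving_vertex_weight[of q s u], where ls = "mults t \<mu>" and ns = "mults t \<nu>" and j = ?j] step jt
    by simp
  finally show ?thesis
    by (simp add: flux_def)
qed

text \<open>Each path has one first and one last edge. The partition function thus agrees with the
  convention that \<open>F_fun\<close> and \<open>G_fun\<close> are zero for mismatched
  lengths.\<close>

lemma collections_empty:
  assumes "length starts \<noteq> length ends"
  shows "collections starts ends = {}"
proof -
  have "size (image_mset first_edge C) = size (image_mset last_edge C)" for C
    by simp
  then show ?thesis
    using assms unfolding collections_def by (metis (mono_tags, lifting) empty_Collect_eq size_mset)
qed

lemma F_fun_row:
  assumes "\<mu> \<in> nonneg_signatures" "\<nu> \<in> nonneg_signatures"
    and "set \<mu> \<subseteq> {..<int t}" "set \<nu> \<subseteq> {..<int t}" and "1 - s * u \<noteq> 0"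
  shows "F_fun q s \<nu> \<mu> [u] = row_weight (vertex_weight q s u) 1 (mults t \<mu>) (mults t \<nu>)"
proof -
  have "F_fun q s \<nu> \<mu> [u] = partition_function q s [u] (row_starts 1 \<mu>) (vertical_edges 1 \<nu>)"
    by (simp add: F_fun_def partition_function_def collections_empty vertical_edges_def left_edges_01)
  then show ?thesis
    using partition_function_row[of 1] assms by simp
qed

lemma G_fun_row:
  assumes "\<mu> \<in> nonneg_signatures" "\<nu> \<in> nonneg_signatures"
    and "set \<mu> \<subseteq> {..<int t}" "set \<nu> \<subseteq> {..<int t}" and "1 - s * u \<noteq> 0"
  shows "G_fun q s \<nu> \<mu> [u] = row_weight (vertex_weight q s u) 0 (mults t \<mu>) (mults t \<nu>)"
proof -
  have "G_fun q s \<nu> \<mu> [u] = partition_function q s [u] (row_starts 0 \<mu>) (vertical_edges 1 \<nu>)"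
    by (simp add: G_fun_def partition_function_def collections_empty vertical_edges_def left_edges_01)
  then show ?thesis
    using partition_function_row[of 0] assms by simp
qed

section \<open>The skew Cauchy identity\<close>

lemma transfer_scale:
  "transfer w1 w2 K (\<lambda>a b. c * \<phi> a b) a b ls ms = c * transfer w1 w2 K \<phi> a b ls ms"
  by (induction w1 w2 K \<phi> a b ls ms rule: transfer.induct) (auto simp: algebra_simps)

text \<open>The conjugating ratio of a column does not involve the horizontal edges, so it comes out
  of every sum.\<close>

lemma row_weight_conj:
  assumes "length ls = length ns"
  shows "row_weight (conj_weight q s v) a ls ns =
    prod_list (map (mult_factor q s) ns) / prod_list (map (mult_factor q s) ls) *
    row_weight (vertex_weight q s v) a ls ns"
  using assms by (induction ls ns arbitrary: a rule: list_induct2) (auto simp: conj_weight_def algebra_simps add_divide_distrib)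

lemma conj_factor_mults:
  assumes "\<nu> \<in> nonneg_signatures" and "set \<nu> \<subseteq> {..<int t}"
  shows "conj_factor q s \<nu> = prod_list (map (mult_factor q s) (mults t \<nu>))"
proof -
  have "conj_factor q s \<nu> = (\<Prod>k\<in>int ` {..<t}. mult_factor q s (count_list \<nu> k))"
    unfolding conj_factor_def mult_factor_def
  proof (rule prod.mono_neutral_left)
    show "set \<nu> \<subseteq> int ` {..<t}"
    proof
      fix x assume "x \<in> set \<nu>"
      then have "x = int (nat x)" "nat x < t"
        using assms by (auto simp: nonneg_signatures_def nat_less_iff)
      then show "x \<in> int ` {..<t}" by blast
    qed
  qed (auto simp: qpoch_def)
  also have "\<dots> = (\<Prod>x<t. mult_factor q s (count_list \<nu> (int x)))"
    by (subst prod.reindex) auto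
  also have "\<dots> = prod_list (map (mult_factor q s) (mults t \<nu>))"
    by (simp add: mults_def comp_def prod.distinct_set_conv_list[symmetric] atLeast0LessThan)
  finally show ?thesis .
qed

lemma Gc_fun_row:
  assumes "\<mu> \<in> nonneg_signatures" "\<nu> \<in> nonneg_signatures"
    and "set \<mu> \<subseteq> {..<int t}" "set \<nu> \<subseteq> {..<int t}" and "1 - s * v \<noteq> 0"
  shows "Gc_fun q s \<nu> \<mu> [v] = row_weight (conj_weight q s v) 0 (mults t \<mu>) (mults t \<nu>)"
  using assms by (simp add: Gc_fun_def row_weight_conj G_fun_row conj_factor_mults)

text \<open>In an empty column conservation gives \<open>a = n + a'\<close> and
  \<open>b = n + b'\<close>, so only \<open>(1, 1)\<close> can drop to \<open>(0, 0)\<close>; after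
  reflection \<open>a' = n + a\<close> and \<open>b' = n + b\<close>, which allows only the opposite
  transition.\<close>

lemma stable_weights:
  assumes gen: "\<And>n::nat. n \<ge> 1 \<Longrightarrow> q ^ n \<noteq> 1" "\<And>n::nat. s\<^sup>2 * q ^ n \<noteq> 1"
    and "1 - s * u \<noteq> 0" and "1 - s * v \<noteq> 0"
  shows "stable (vertex_weight q s u) (conj_weight q s v) ((u - s) / (1 - s * u) * ((v - s) / (1 - s * v)))"
    and "stable (reflect (conj_weight q s v)) (reflect (vertex_weight q s u))
           ((u - s) / (1 - s * u) * ((v - s) / (1 - s * v)))"
  using assms(3,4) by (auto simp: stable_def reflect_def vertex_weight_def conj_weight_eq[OF gen] of_bool_def mult.commute)

theorem theorem4p2:
  fixes q s u v :: complex and lam mu :: "int list"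
  assumes "\<And>n::nat. n \<ge> 1 \<Longrightarrow> q ^ n \<noteq> 1"
    and "\<And>n::nat. s\<^sup>2 * q ^ n \<noteq> 1"
    and "1 - s * u \<noteq> 0" and "1 - s * v \<noteq> 0" and "1 - u * v \<noteq> 0"
    and "norm ((u - s) / (1 - s * u) * ((v - s) / (1 - s * v))) < 1"
    and "lam \<in> nonneg_signatures" and "mu \<in> nonneg_signatures"
  shows "(\<lambda>\<kappa>. Gc_fun q s lam \<kappa> [v] * F_fun q s mu \<kappa> [u]) summable_on nonneg_signatures
    \<and> ((\<lambda>\<nu>. F_fun q s \<nu> lam [u] * Gc_fun q s \<nu> mu [v]) has_sum
        (1 - q * u * v) / (1 - u * v) *
          (\<Sum>\<^sub>\<infinity>\<kappa>\<in>nonneg_signatures. Gc_fun q s lam \<kappa> [v] * F_fun q s mu \<kappa> [u]))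
       nonneg_signatures"
proof -
  note gen = assms(1,2)
  let ?w = "vertex_weight q s u" and ?c = "conj_weight q s v"
  let ?r = "(u - s) / (1 - s * u) * ((v - s) / (1 - s * v))"
  \<comment> \<open>Nonzero terms have \<open>\<nu>\<close> of length \<open>length lam + 1\<close>
    and \<open>\<kappa>\<close> of length \<open>length lam\<close>, and
    \<open>Suc l \<le> K\<close> holds for each multiplicity \<open>l\<close> of
    \<open>lam\<close>.\<close>
  define K where "K = Suc (length lam)"
  obtain t where t: "\<forall>x\<in>nat ` (set lam \<union> set mu). x < t"
    by (meson finite_Un finite_imageI finite_nat_set_iff_bounded finite_set)
  have "x < int t" if "x \<in> set lam \<union> set mu" for x
    using bspec[OF t imageI[OF that]] by linarith
  then have bounds: "set lam \<subseteq> {..<int t}" "set mu \<subseteq> {..<int t}"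
    by auto
  have extend: "set lam \<subseteq> {..<int (t + k)}" "set mu \<subseteq> {..<int (t + k)}" for k
    using bounds by force+
  \<comment> \<open>The \<open>v\<close> row starts with an empty left edge and the \<open>u\<close>
    row with an occupied one.\<close>
  let ?B = "transfer (reflect ?c) (reflect ?w) K empty_state 0 1 (mults t lam) (mults t mu)"
  have rhs: "((\<lambda>\<kappa>. Gc_fun q s lam \<kappa> [v] * F_fun q s mu \<kappa> [u]) has_sum ?B) nonneg_signatures"
  proof -
    \<comment> \<open>On this side \<open>(1, 1)\<close> cannot drop to \<open>(0, 0)\<close>, so
      the limit state is the empty state and no geometric factor arises.\<close>
    have "column (reflect ?c) (reflect ?w) K 0 0 1 1 0 0 = 0"
      unfolding column_def by (intro sum.neutral) (auto simp: reflect_def conj_weight_eq[OF gen])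
    then have "transfer (reflect ?c) (reflect ?w) K (limit_state (reflect ?c) (reflect ?w) K ?r) 0 1
        (mults t lam) (mults t mu) = ?B"
      by (intro transfer_cong) (auto simp: limit_state_def empty_state_def)
    moreover have "((\<lambda>\<kappa>. Gc_fun q s lam \<kappa> [v] * F_fun q s mu \<kappa> [u]) has_sum
        transfer (reflect ?c) (reflect ?w) K (limit_state (reflect ?c) (reflect ?w) K ?r) 0 1
        (mults t lam) (mults t mu)) nonneg_signatures"
    proof (intro has_sum_signatures[OF stable_weights(2)] bounds assms(6) gen assms(3,4))
      fix \<kappa> k assume kap: "\<kappa> \<in> nonneg_signatures" "set \<kappa> \<subseteq> {..<int (t + k)}"
      have "Gc_fun q s lam \<kappa> [v] = row_weight ?c 0 (mults (t + k) \<kappa>) (mults (t + k) lam)"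
        by (intro Gc_fun_row kap assms extend)
      moreover have "F_fun q s mu \<kappa> [u] = row_weight ?w 1 (mults (t + k) \<kappa>) (mults (t + k) mu)"
        by (intro F_fun_row kap assms extend)
      ultimately show "Gc_fun q s lam \<kappa> [v] * F_fun q s mu \<kappa> [u] =
          row_weight (reflect ?c) 0 (mults (t + k) lam) (mults (t + k) \<kappa>) *
          row_weight (reflect ?w) 1 (mults (t + k) mu) (mults (t + k) \<kappa>)"
        by (simp only: row_weight_reflect)
    qed (auto simp: Gc_fun_def G_fun_def K_def)
    ultimately show ?thesis by simp
  qed
  have "((\<lambda>\<nu>. F_fun q s \<nu> lam [u] * Gc_fun q s \<nu> mu [v]) has_sum
      transfer ?w ?c K (limit_state ?w ?c K ?r) 1 0 (mults t lam) (mults t mu)) nonneg_signatures"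
  proof (intro has_sum_signatures[OF stable_weights(1)] bounds assms(6) gen assms(3,4))
    fix \<nu> k assume nu: "\<nu> \<in> nonneg_signatures" "set \<nu> \<subseteq> {..<int (t + k)}"
    have "F_fun q s \<nu> lam [u] = row_weight ?w 1 (mults (t + k) lam) (mults (t + k) \<nu>)"
      by (intro F_fun_row nu assms extend)
    moreover have "Gc_fun q s \<nu> mu [v] = row_weight ?c 0 (mults (t + k) mu) (mults (t + k) \<nu>)"
      by (intro Gc_fun_row nu assms extend)
    ultimately show "F_fun q s \<nu> lam [u] * Gc_fun q s \<nu> mu [v] =
        row_weight ?w 1 (mults (t + k) lam) (mults (t + k) \<nu>) *
        row_weight ?c 0 (mults (t + k) mu) (mults (t + k) \<nu>)"
      by simp
  qed (auto simp: F_fun_def K_def)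
  moreover have "transfer ?w ?c K (limit_state ?w ?c K ?r) 1 0 (mults t lam) (mults t mu) =
      (1 - q * u * v) / (1 - u * v) * ?B"
  proof -
    \<comment> \<open>Chosen so that the exchange matrix sends it to the limit state: the entry at
      \<open>(0, 0)\<close> becomes \<open>1\<close> and that at \<open>(1, 1)\<close> becomes
      \<open>(1 - q) / (1 - u * v)\<close>.\<close>
    let ?\<phi> = "\<lambda>a b. 1 / (1 - u * v) * empty_state a b"
    have s1: "1 - s\<^sup>2 \<noteq> 0"
      using gen(2)[of 0] by simp
    have "column ?w ?c K 0 0 1 1 0 0 = (1 - q) * (1 - s\<^sup>2) / ((1 - s * u) * (1 - s * v))"
      by (subst column_vertex_weight) (auto simp: K_def vertex_weight_def conj_weight_eq[OF gen])
    moreover have "1 - ?r = (1 - s\<^sup>2) * (1 - u * v) / ((1 - s * u) * (1 - s * v))"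
      using assms(3,4) by (simp add: divide_simps) (simp add: algebra_simps power2_eq_square)
    ultimately have "column ?w ?c K 0 0 1 1 0 0 / (1 - ?r) = (1 - q) / (1 - u * v)"
      using assms(3-5) s1 by simp
    then have "transfer ?w ?c K (limit_state ?w ?c K ?r) 1 0 (mults t lam) (mults t mu) =
        transfer ?w ?c K (exchange q (u * v) ?\<phi>) 1 0 (mults t lam) (mults t mu)"
      using assms(5) by (intro transfer_cong) (auto simp: limit_state_def exchange_def empty_state_def)
    \<comment> \<open>On the unequal left state \<open>(1, 0)\<close> the exchange matrix is this
      scalar.\<close>
    also have "\<dots> = (1 - q * (u * v)) *
        transfer (reflect ?c) (reflect ?w) K (\<lambda>b a. ?\<phi> a b) 0 1 (mults t lam) (mults t mu)"
      by (subst transfer_exchange[OF gen])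
        (auto simp: exchange_def K_def mults_def count_le_length)
    also have "(\<lambda>b a. ?\<phi> a b) = ?\<phi>"
      by (auto simp: empty_state_def fun_eq_iff)
    finally show ?thesis
      unfolding transfer_scale by (simp add: mult.assoc)
  qed
  ultimately show ?thesis
    using rhs by (simp add: infsumI has_sum_imp_summable)
qed

end
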